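(* Let $d\ge 2$, let $T$ be the $d$-regular rooted tree, and let $G\le \mathrm{Aut}(T)$ be a super strongly fractal branch profinite group (i.e. a closed subgroup of $\mathrm{Aut}(T)$ that is both super strongly fractal and branch) with normalized Haar measure $\mu$. Then almost surely, for every $k\ge 1$, a $k$-generated random subgroup of $G$ is a free group of rank $k$ which acts freely on $\partial T$. That is, for every $k\ge 1$ and for $\mu^k$-almost every $(g_1,\dots,g_k)\in G^k$, the subgroup $H=\langle g_1,\dots,g_k\rangle$ is a free group of rank $k$, and no non-trivial element of $H$ fixes a point of $\partial T$.
   Context: The $d$-regular rooted tree $T$ is identified with the free monoid on $X=\{1,\dots,d\}$: vertices are finite words over $X$, the root is the empty word $\emptyset$, and each vertex $v$ is adjacent to its $d$ descendants $vx$, $x\in X$. The $n$-th level $\mathcal{L}_n$ is the set of words of length $n$. The boundary $\partial T$ is the set of infinite words over $X$. For a vertex $v$, $T_v$ is the subtree rooted at $v$, which is identified with $T$ by deleting the prefix $v$. $\mathrm{Aut}(T)$ is the group of graph automorphisms of $T$ fixing the root, acting on the right; $v\cdot g$ is the image of $v$ under $g$. It also acts on $\partial T$. $\mathrm{St}(n)$ is the pointwise stabilizer of $\mathcal{L}_n$; the subgroups $\mathrm{St}(n)$, $n\ge 1$, form a basis of neighborhoods of the identity for the congruence topology, which makes $\mathrm{Aut}(T)$ a profinite group. Topological notions refer to this topology; a profinite subgroup $G\le \mathrm{Aut}(T)$ means a closed one, and it has a unique normalized Haar measure $\mu$; $\mu^k$ is the product measure on $G^k$. For $g\in\mathrm{Aut}(T)$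 and a vertex $v$, the section $g|_v\in \mathrm{Aut}(T)$ is the unique automorphism with $(vw)\cdot g=(v\cdot g)(w\cdot g|_v)$ for all words $w$. Write $\varphi_v(g)=g|_v$. For $G\le \mathrm{Aut}(T)$, put $\mathrm{St}_G(n)=\mathrm{St}(n)\cap G$. $G$ is level-transitive if it acts transitively on $\mathcal{L}_n$ for every $n\ge1$. $G$ is self-similar if $g|_v\in G$ for all $g\in G$ and all vertices $v$. $G$ is super strongly fractal if it is self-similar, level-transitive, and $\varphi_v(\mathrm{St}_G(n))=G$ for all $n\ge 1$ and $v\in\mathcal{L}_n$. The rigid vertex stabilizer $\mathrm{rist}_G(v)$ is the subgroup of elements of $G$ fixing every vertex not in $T_v$, and $\mathrm{Rist}_G(n)$ is the subgroup generated by all $\mathrm{rist}_G(v)$ with $v\in\mathcal{L}_n$. $G$ is branch if it is level-transitive and $\mathrm{Rist}_G(n)$ has finite index in $G$ for all $n\ge 1$. A $k$-generated random subgroup of $G$ is the (abstract) subgroup generated by $k$ independent Haar-random elements of $G$. *)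

theory Defs
  imports
    "HOL-Library.Sublist"
    "HOL-Algebra.Coset"
    "HOL-Algebra.Generated_Groups"
    "HOL-Probability.Probability"
begin

text \<open>
  The \<open>d\<close>-regular rooted tree is the free monoid \<^typ>\<open>'x list\<close> over a finite alphabet \<^typ>\<open>'x\<close>
  with \<open>d = CARD('x)\<close>; the root is the empty word.
\<close>

definition adjacent :: "'x list \<Rightarrow> 'x list \<Rightarrow> bool" where
  "adjacent u v \<longleftrightarrow> (\<exists>x. v = u @ [x]) \<or> (\<exists>x. u = v @ [x])"

definition level :: "nat \<Rightarrow> 'x list set" where
  "level n = {v. length v = n}"

text \<open>
  Automorphisms act on the right: the vertex \<open>v \<cdot> g\<close> is written \<open>g v\<close> below, and the product
  of \<open>g\<close> and \<open>h\<close> is ``first \<open>g\<close>, then \<open>h\<close>''.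
\<close>

definition Aut :: "('x list \<Rightarrow> 'x list) monoid" where
  "Aut = \<lparr>carrier = {g. bij g \<and> g [] = [] \<and> (\<forall>u v. adjacent (g u) (g v) \<longleftrightarrow> adjacent u v)},
          monoid.mult = (\<lambda>g h. h \<circ> g), one = id\<rparr>"

lemma Aut_sel [simp]:
  "g \<otimes>\<^bsub>Aut\<^esub> h = h \<circ> g" "\<one>\<^bsub>Aut\<^esub> = id"
  by (simp_all add: Aut_def)

lemma Aut_inv_closed: "g \<in> carrier Aut \<Longrightarrow> inv_into UNIV g \<in> carrier Aut"
  unfolding Aut_def
  by (auto simp: bij_imp_bij_inv) (metis bij_inv_eq_iff)+

lemma group_Aut: "group Aut"
proof (rule groupI)
  fix g :: "'x list \<Rightarrow> 'x list" assume g: "g \<in> carrier Aut"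
  have "inv_into UNIV g \<otimes>\<^bsub>Aut\<^esub> g = \<one>\<^bsub>Aut\<^esub>"
    using g by (auto simp: Aut_def fun_eq_iff bij_is_surj surj_f_inv_f)
  with Aut_inv_closed[OF g] show "\<exists>h\<in>carrier Aut. h \<otimes>\<^bsub>Aut\<^esub> g = \<one>\<^bsub>Aut\<^esub>" by blast
qed (auto simp: Aut_def bij_comp o_assoc)

lemma Aut_adjacent: "g \<in> carrier Aut \<Longrightarrow> adjacent (g u) (g v) \<longleftrightarrow> adjacent u v"
  and Aut_Nil: "g \<in> carrier Aut \<Longrightarrow> g [] = []"
  and Aut_bij: "g \<in> carrier Aut \<Longrightarrow> bij g"
  by (simp_all add: Aut_def)

lemma AutI:
  assumes "bij g" "g [] = []" "\<And>u v. adjacent (g u) (g v) \<longleftrightarrow> adjacent u v"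
  shows "g \<in> carrier Aut"
  using assms by (simp add: Aut_def)

lemma Aut_snoc:
  assumes "g \<in> carrier Aut"
  shows "\<exists>z. g (v @ [x]) = g v @ [z]"
proof (induction v arbitrary: x rule: rev_induct)
  case Nil
  have "adjacent (g []) (g [x])"
    unfolding Aut_adjacent[OF assms] by (simp add: adjacent_def)
  thus ?case by (simp add: Aut_Nil[OF assms] adjacent_def)
next
  case (snoc y u)
  obtain z where z: "g (u @ [y]) = g u @ [z]" using snoc.IH by blast
  have "adjacent (g (u @ [y])) (g ((u @ [y]) @ [x]))"
    unfolding Aut_adjacent[OF assms] by (simp add: adjacent_def)
  moreover have "g ((u @ [y]) @ [x]) \<noteq> g u"
    using bij_is_inj[OF Aut_bij[OF assms]] by (auto dest: injD)
  ultimately show ?case using z by (auto simp: adjacent_def)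
qed

lemma Aut_length: "g \<in> carrier Aut \<Longrightarrow> length (g v) = length v"
proof (induction v rule: rev_induct)
  case (snoc x v)
  then show ?case using Aut_snoc[of g v x] by auto
qed (simp add: Aut_def)

definition section_at :: "('x list \<Rightarrow> 'x list) \<Rightarrow> 'x list \<Rightarrow> ('x list \<Rightarrow> 'x list)" where
  "section_at g v = (\<lambda>w. drop (length v) (g (v @ w)))"

lemma section_at_append:
  assumes "g \<in> carrier Aut"
  shows "g (v @ w) = g v @ section_at g v w"
proof -
  have "\<exists>s. g (v @ w) = g v @ s"
  proof (induction w rule: rev_induct)
    case (snoc x w)
    then show ?case using Aut_snoc[OF assms, of "v @ w" x] by auto
  qed simp
  then obtain s where "g (v @ w) = g v @ s" by blast
  then show ?thesis by (simp add: section_at_def Aut_length[OF assms])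
qed

lemma section_at_closed:
  assumes g: "g \<in> carrier Aut"
  shows "section_at g v \<in> carrier Aut"
proof -
  note app = section_at_append[OF g]
  have inj: "inj g" and surj: "surj g" using Aut_bij[OF g] by (auto simp: bij_def)
  have "inj (section_at g v)"
  proof (rule injI)
    fix a b assume "section_at g v a = section_at g v b"
    hence "g (v @ a) = g (v @ b)" by (simp only: app)
    hence "v @ a = v @ b" by (rule injD[OF inj])
    thus "a = b" by simp
  qed
  moreover have "surj (section_at g v)"
  proof -
    have "\<exists>w. y = section_at g v w" for y
    proof -
      obtain u where u: "g u = g v @ y" using surjD[OF surj, of "g v @ y"] by auto
      have len: "length u = length v + length y"
        using arg_cong[OF u, of length] by (simp add: Aut_length[OF g])
      define a b where "a = take (length v) u" and "b = drop (length v) u"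
      have ua: "u = a @ b" by (simp add: a_def b_def)
      have la: "length a = length v" using len by (simp add: a_def)
      have eq: "g a @ section_at g a b = g v @ y"
        using u unfolding ua app[of a b] .
      have "length (g a) = length (g v)" by (simp add: Aut_length[OF g] la)
      hence "g a = g v" using eq by simp
      hence "a = v" by (rule injD[OF inj])
      thus ?thesis using eq by auto
    qed
    thus ?thesis unfolding surj_def by blast
  qed
  moreover have "section_at g v [] = []"
    by (simp add: section_at_def Aut_length[OF g])
  moreover have "adjacent (section_at g v a) (section_at g v b) \<longleftrightarrow> adjacent a b" for a b
  proof -
    have shift: "adjacent (c @ a) (c @ b) \<longleftrightarrow> adjacent a b" for c a b :: "'a list"
      by (auto simp: adjacent_def)
    have "adjacent (g (v @ a)) (g (v @ b)) \<longleftrightarrow> adjacent (v @ a) (v @ b)"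
      by (rule Aut_adjacent[OF g])
    thus ?thesis by (simp only: app shift)
  qed
  ultimately show ?thesis by (intro AutI bijI)
qed

lemma section_at_unique:
  assumes "g \<in> carrier Aut"
  shows "section_at g v = (THE h. h \<in> carrier Aut \<and> (\<forall>w. g (v @ w) = g v @ h w))"
proof (rule the_equality[symmetric])
  show "section_at g v \<in> carrier Aut \<and> (\<forall>w. g (v @ w) = g v @ section_at g v w)"
    using assms section_at_append section_at_closed by blast
next
  fix h assume "h \<in> carrier Aut \<and> (\<forall>w. g (v @ w) = g v @ h w)"
  thus "h = section_at g v"
    using section_at_append[OF assms, of v] by (auto simp: fun_eq_iff)
qed

definition St :: "nat \<Rightarrow> ('x list \<Rightarrow> 'x list) set" where
  "St n = {g \<in> carrier Aut. \<forall>v\<in>level n. g v = v}"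

lemma St_mono:
  assumes "m \<le> n" shows "St n \<subseteq> St m"
proof
  fix g :: "'x list \<Rightarrow> 'x list" assume "g \<in> St n"
  hence g: "g \<in> carrier Aut" and fx: "\<And>v. length v = n \<Longrightarrow> g v = v"
    by (auto simp: St_def level_def)
  have "g v = v" if "length v = m" for v
  proof -
    let ?w = "replicate (n - m) undefined"
    have "g v @ section_at g v ?w = v @ ?w"
      using fx[of "v @ ?w"] that assms section_at_append[OF g, of v ?w] by simp
    thus ?thesis using Aut_length[OF g, of v] by simp
  qed
  thus "g \<in> St m" using g by (auto simp: St_def level_def)
qed

definition congruence_topology :: "('x list \<Rightarrow> 'x list) topology" where
  "congruence_topology =
     topology (\<lambda>U. U \<subseteq> carrier Aut \<and> (\<forall>g\<in>U. \<exists>n\<ge>1. St n #>\<^bsub>Aut\<^esub> g \<subseteq> U))"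

lemma openin_congruence_topology:
  "openin congruence_topology U \<longleftrightarrow>
     U \<subseteq> carrier Aut \<and> (\<forall>g\<in>U. \<exists>n\<ge>1. St n #>\<^bsub>Aut\<^esub> g \<subseteq> U)"
proof -
  have mono: "St n #>\<^bsub>Aut\<^esub> g \<subseteq> St m #>\<^bsub>Aut\<^esub> g" if "m \<le> n" for m n and g :: "'x list \<Rightarrow> 'x list"
    using St_mono[OF that] by (auto simp: r_coset_def)
  have "istopology (\<lambda>U::('x list \<Rightarrow> 'x list) set.
          U \<subseteq> carrier Aut \<and> (\<forall>g\<in>U. \<exists>n\<ge>1. St n #>\<^bsub>Aut\<^esub> g \<subseteq> U))"
    unfolding istopology_def
  proof (rule conjI; intro allI impI conjI ballI)
    fix \<K> :: "('x list \<Rightarrow> 'x list) set set" and g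
    assume K: "\<forall>U\<in>\<K>. U \<subseteq> carrier Aut \<and> (\<forall>g\<in>U. \<exists>n\<ge>1. St n #>\<^bsub>Aut\<^esub> g \<subseteq> U)"
    show "\<Union>\<K> \<subseteq> carrier Aut" using K by (intro Union_least) simp
    assume "g \<in> \<Union>\<K>"
    then obtain U where U: "U \<in> \<K>" "g \<in> U" by (rule UnionE)
    then obtain n where n: "n \<ge> 1" "St n #>\<^bsub>Aut\<^esub> g \<subseteq> U" using K by meson
    moreover have "U \<subseteq> \<Union>\<K>" using U(1) by (rule Union_upper)
    ultimately show "\<exists>n\<ge>1. St n #>\<^bsub>Aut\<^esub> g \<subseteq> \<Union>\<K>" by (meson order_trans)
  next
    fix S T :: "('x list \<Rightarrow> 'x list) set" and g
    assume S: "S \<subseteq> carrier Aut \<and> (\<forall>g\<in>S. \<exists>n\<ge>1. St n #>\<^bsub>Aut\<^esub> g \<subseteq> S)"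
      and T: "T \<subseteq> carrier Aut \<and> (\<forall>g\<in>T. \<exists>n\<ge>1. St n #>\<^bsub>Aut\<^esub> g \<subseteq> T)"
    show "S \<inter> T \<subseteq> carrier Aut" using S by (meson Int_lower1 order_trans)
    assume g: "g \<in> S \<inter> T"
    obtain m n where m: "m \<ge> 1" "St m #>\<^bsub>Aut\<^esub> g \<subseteq> S" and n: "n \<ge> 1" "St n #>\<^bsub>Aut\<^esub> g \<subseteq> T"
      using S T g by (meson IntD1 IntD2)
    have "St (max m n) #>\<^bsub>Aut\<^esub> g \<subseteq> S \<inter> T"
      using m(2) n(2) mono[of m "max m n" g] mono[of n "max m n" g] by auto
    thus "\<exists>n\<ge>1. St n #>\<^bsub>Aut\<^esub> g \<subseteq> S \<inter> T"
      using m(1) by (intro exI[of _ "max m n"]) auto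
  qed
  thus ?thesis unfolding congruence_topology_def by (subst topology_inverse') simp_all
qed

definition profinite_subgroup :: "('x list \<Rightarrow> 'x list) set \<Rightarrow> bool" where
  "profinite_subgroup G \<longleftrightarrow> subgroup G Aut \<and> closedin congruence_topology G"

text \<open>
  A closed \<open>G\<close> is compact and metrizable when the alphabet is finite, so every finite Borel measure on it is
  regular and regularity need not be required; left invariance and total mass 1 determine the measure.
\<close>

definition normalized_Haar ::
  "('x list \<Rightarrow> 'x list) set \<Rightarrow> ('x list \<Rightarrow> 'x list) measure \<Rightarrow> bool" where
  "normalized_Haar G \<mu> \<longleftrightarrow>
     prob_space \<mu> \<and>
     sets \<mu> = sets (sigma G {U. openin (subtopology congruence_topology G) U}) \<and>
     (\<forall>g\<in>G. \<forall>A\<in>sets \<mu>. emeasure \<mu> (g <#\<^bsub>Aut\<^esub> A) = emeasure \<mu> A)"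

definition level_transitive :: "('x list \<Rightarrow> 'x list) set \<Rightarrow> bool" where
  "level_transitive G \<longleftrightarrow> (\<forall>n\<ge>1. \<forall>u\<in>level n. \<forall>v\<in>level n. \<exists>g\<in>G. g u = v)"

definition self_similar :: "('x list \<Rightarrow> 'x list) set \<Rightarrow> bool" where
  "self_similar G \<longleftrightarrow> (\<forall>g\<in>G. \<forall>v. section_at g v \<in> G)"

definition super_strongly_fractal :: "('x list \<Rightarrow> 'x list) set \<Rightarrow> bool" where
  "super_strongly_fractal G \<longleftrightarrow>
     self_similar G \<and> level_transitive G \<and>
     (\<forall>n\<ge>1. \<forall>v\<in>level n. (\<lambda>g. section_at g v) ` (St n \<inter> G) = G)"

definition rist :: "('x list \<Rightarrow> 'x list) set \<Rightarrow> 'x list \<Rightarrow> ('x list \<Rightarrow> 'x list) set" where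
  "rist G v = {g \<in> G. \<forall>u. \<not> prefix v u \<longrightarrow> g u = u}"

definition Rist :: "('x list \<Rightarrow> 'x list) set \<Rightarrow> nat \<Rightarrow> ('x list \<Rightarrow> 'x list) set" where
  "Rist G n = generate Aut (\<Union>v\<in>level n. rist G v)"

definition branch :: "('x list \<Rightarrow> 'x list) set \<Rightarrow> bool" where
  "branch G \<longleftrightarrow>
     level_transitive G \<and> (\<forall>n\<ge>1. finite (rcosets\<^bsub>Aut\<lparr>carrier := G\<rparr>\<^esub> (Rist G n)))"

text \<open>The boundary consists of the infinite words \<^typ>\<open>nat \<Rightarrow> 'x\<close>.\<close>

definition boundary_act :: "('x list \<Rightarrow> 'x list) \<Rightarrow> (nat \<Rightarrow> 'x) \<Rightarrow> (nat \<Rightarrow> 'x)" where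
  "boundary_act g \<xi> = (\<lambda>n. g (map \<xi> [0..<Suc n]) ! n)"

lemma boundary_act_prefix:
  assumes "g \<in> carrier Aut"
  shows "map (boundary_act g \<xi>) [0..<n] = g (map \<xi> [0..<n])"
proof (induction n)
  case 0
  show ?case using assms by (simp add: Aut_def)
next
  case (Suc n)
  obtain z where z: "g (map \<xi> [0..<n] @ [\<xi> n]) = g (map \<xi> [0..<n]) @ [z]"
    using Aut_snoc[OF assms] by blast
  have "boundary_act g \<xi> n = z"
    using z Aut_length[OF assms, of "map \<xi> [0..<n]"]
    by (simp add: boundary_act_def nth_append)
  thus ?case using Suc z by simp
qed

definition acts_freely_on_boundary :: "('x list \<Rightarrow> 'x list) set \<Rightarrow> bool" where
  "acts_freely_on_boundary H \<longleftrightarrow> (\<forall>h\<in>H. h \<noteq> \<one>\<^bsub>Aut\<^esub> \<longrightarrow> (\<forall>\<xi>. boundary_act h \<xi> \<noteq> \<xi>))"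

text \<open>
  The free group on a set \<open>I\<close>: reduced words in the letters \<open>(i, True)\<close>, standing for the
  generator \<open>i\<close>, and \<open>(i, False)\<close>, standing for its inverse. Words are multiplied by
  concatenation followed by free reduction.
\<close>

definition letter_inv :: "'i \<times> bool \<Rightarrow> 'i \<times> bool" where
  "letter_inv a = (fst a, \<not> snd a)"

definition reduced :: "('i \<times> bool) list \<Rightarrow> bool" where
  "reduced w \<longleftrightarrow> successively (\<lambda>a b. b \<noteq> letter_inv a) w"

fun red_cons :: "'i \<times> bool \<Rightarrow> ('i \<times> bool) list \<Rightarrow> ('i \<times> bool) list" where
  "red_cons a [] = [a]"
| "red_cons a (b # w) = (if b = letter_inv a then w else a # b # w)"

definition free_group :: "'i set \<Rightarrow> ('i \<times> bool) list monoid" where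
  "free_group I = \<lparr>carrier = {w. reduced w \<and> fst ` set w \<subseteq> I},
                   monoid.mult = (\<lambda>u v. foldr red_cons u v), one = []\<rparr>"

lemma letter_inv_inv [simp]: "letter_inv (letter_inv a) = a"
  by (simp add: letter_inv_def)

lemma reduced_red_cons: "reduced w \<Longrightarrow> reduced (red_cons a w)"
  by (cases w) (auto simp: reduced_def successively_Cons)

lemma reduced_foldr: "reduced v \<Longrightarrow> reduced (foldr red_cons u v)"
  by (induction u) (auto intro: reduced_red_cons)

lemma red_cons_inv:
  assumes "reduced w"
  shows "red_cons a (red_cons (letter_inv a) w) = w"
proof (cases w)
  case (Cons b w')
  show ?thesis
  proof (cases "b = a")
    case True
    then show ?thesis using assms Cons by (cases w') (auto simp: reduced_def)
  qed (use Cons in simp)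
qed simp

lemma red_cons_reduced: "reduced (a # w) \<Longrightarrow> red_cons a w = a # w"
  by (cases w) (auto simp: reduced_def successively_Cons)

lemma foldr_red_cons_Nil: "reduced w \<Longrightarrow> foldr red_cons w [] = w"
proof (induction w)
  case (Cons a w)
  then have "reduced w" by (auto simp: reduced_def successively_Cons)
  then show ?case using Cons by (simp add: red_cons_reduced)
qed simp

lemma foldr_red_cons_red_cons:
  assumes "reduced v"
  shows "foldr red_cons (red_cons a u) v = red_cons a (foldr red_cons u v)"
proof (cases u)
  case (Cons b u')
  then show ?thesis
    using red_cons_inv[OF reduced_foldr[OF assms], of a u'] by auto
qed simp

lemma foldr_red_cons_assoc:
  assumes "reduced w"
  shows "foldr red_cons (foldr red_cons u v) w = foldr red_cons u (foldr red_cons v w)"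
  by (induction u) (auto simp: foldr_red_cons_red_cons[OF assms])

lemma set_foldr_red_cons: "fst ` set (foldr red_cons u v) \<subseteq> fst ` set u \<union> fst ` set v"
proof (induction u)
  case (Cons a u)
  have "set (red_cons a w) \<subseteq> insert a (set w)" for w by (cases w) auto
  from image_mono[OF this, of fst "foldr red_cons u v"] show ?case
    using Cons by auto
qed simp

lemma group_free_group: "group (free_group I)"
proof (rule groupI)
  fix x assume x: "x \<in> carrier (free_group I)"
  define y where "y = rev (map letter_inv x)"
  have "foldr red_cons (rev (map letter_inv u)) (u @ v) = v" if "reduced (u @ v)" for u v :: "('a \<times> bool) list"
    using that
  proof (induction u)
    case (Cons a u)
    have "red_cons (letter_inv a) (a # u @ v) = u @ v" by simp
    moreover have "reduced (u @ v)" using Cons.prems by (auto simp: reduced_def successively_Cons)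
    ultimately show ?case using Cons.IH by simp
  qed simp
  from this[of x "[]"] have "foldr red_cons y x = []"
    using x by (simp add: y_def free_group_def)
  moreover have "reduced y"
    using x unfolding y_def free_group_def reduced_def
    by (auto simp: successively_map successively_rev elim!: successively_mono)
  moreover have "fst ` set y \<subseteq> I"
    using x by (auto simp: y_def free_group_def letter_inv_def)
  ultimately show "\<exists>y\<in>carrier (free_group I). y \<otimes>\<^bsub>free_group I\<^esub> x = \<one>\<^bsub>free_group I\<^esub>"
    by (auto simp: free_group_def)
next
  fix x y assume "x \<in> carrier (free_group I)" "y \<in> carrier (free_group I)"
  then show "x \<otimes>\<^bsub>free_group I\<^esub> y \<in> carrier (free_group I)"
    using subset_trans[OF set_foldr_red_cons[of x y], of I]
    by (simp add: free_group_def reduced_foldr)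
qed (auto simp: free_group_def foldr_red_cons_assoc reduced_def)

definition free_group_of_rank :: "('a, 'b) monoid_scheme \<Rightarrow> nat \<Rightarrow> bool" where
  "free_group_of_rank H k \<longleftrightarrow> H \<cong> free_group {..<k}"

end

theory Submission imports Defs begin

text \<open>
  Why the theorem is true. It suffices to show, for each non-empty reduced word \<open>w\<close> in \<open>k\<close>
  letters, that for almost every tuple \<open>(g\<^sub>1, \<dots>, g\<^sub>k)\<close>, the element \<open>w(g)\<close> fixes no point of the boundary.
  As there are countably many words, this settles both claims, because an element that fixes no
  boundary point is not the identity.

  A single random element (lemma \<open>prob_fixing_arbitrarily_small\<close>). Let \<open>X\<^sub>n(g)\<close> be the number of
  vertices of level \<open>n\<close> fixed by \<open>g\<close>. Super strong fractality says that, given the action of \<open>g\<close> on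
  level \<open>n\<close>, its section at a fixed vertex is again Haar distributed on \<open>G\<close>; by level transitivity it
  fixes one vertex of each level on average, so \<open>X\<^sub>n\<close> is a martingale with mean 1. Doob's
  inequality bounds the probability that \<open>X\<close> ever reaches \<open>M\<close> by \<open>1/M\<close>. On the other hand, as long as
  \<open>X\<^sub>n\<close> is positive, there is a chance bounded below, independently of \<open>n\<close>, that the section at a fixed
  vertex acts trivially on the next \<open>j\<close> levels, which forces \<open>X\<close> up to at least \<open>d\<^sup>j\<close>. Hence
  \<open>X\<^sub>n\<close> cannot stay between 1 and \<open>M\<close>, and the probability of \<open>X\<^sub>n > 0\<close> tends to 0.

  Words (lemma \<open>measure_loop_fixing_below_le\<close>). Take a tuple for which \<open>w(g)\<close> fixes a boundary point
  \<open>\<xi>\<close>, with \<open>w\<close> as short as possible. The images of \<open>\<xi>\<close> under the proper initial segments of \<open>w\<close> are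
  then distinct, so at some level \<open>n\<close> the corresponding vertices form a simple loop that starts and
  ends at a vertex \<open>v\<close>. Let \<open>i\<close> be the index of the first letter, and let \<open>u\<close> be the vertex at which
  this letter uses the section of \<open>g\<^sub>i\<close>. Since the loop is simple and \<open>w\<close> is reduced, no other
  letter uses that section. Multiplying \<open>g\<^sub>i\<close> on the left by an element of the rigid stabilizer of \<open>u\<close>
  therefore keeps the loop and changes \<open>w(g)\<close> below \<open>v\<close> in exactly one factor. By invariance of the
  measure one may average over such elements. Because \<open>G\<close> is branch, their sections at \<open>u\<close> form a
  subgroup of \<open>G\<close> of index at most some finite \<open>C\<close>, so the average is at most \<open>C\<close> times the probability that one random
  element of \<open>G\<close> fixes a vertex of level \<open>m\<close>. This tends to 0 with growing \<open>m\<close>, so the event is null. There are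
  countably many words, loops and vertices, and a tuple outside these null events has no word with
  a fixed boundary point (lemma \<open>words_without_fixed_ends\<close>).

  All arguments take place on finite levels: neither Haar measure on the rigid stabilizers
  nor conditional expectations are formed, only finite averages over left translates.
\<close>

section \<open>Tree automorphisms and finite levels\<close>

lemma finite_level: "finite (level n :: 'x::finite list set)"
  and card_level: "card (level n :: 'x::finite list set) = CARD('x) ^ n"
proof -
  have eq: "level n = {xs :: 'x list. set xs \<subseteq> UNIV \<and> length xs = n}" by (auto simp: level_def)
  show "finite (level n :: 'x list set)" "card (level n :: 'x list set) = CARD('x) ^ n"
    unfolding eq using finite_lists_length_eq[of "UNIV :: 'x set" n] card_lists_length_eq[of "UNIV :: 'x set" n] by simp_all
qed

lemma Aut_take:
  assumes "g \<in> carrier Aut"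
  shows "take i (g v) = g (take i v)"
proof -
  have "g v = g (take i v) @ section_at g (take i v) (drop i v)"
    using section_at_append[OF assms, of "take i v" "drop i v"] by simp
  then show ?thesis using Aut_length[OF assms, of "take i v"]
    by (metis Aut_length append_eq_conv_conj assms append_take_drop_id length_take min_def take_all_iff)
qed

lemma section_fixed_iff:
  assumes "g \<in> carrier Aut" "g v = v"
  shows "g (v @ x) = v @ y \<longleftrightarrow> section_at g v x = y"
  using section_at_append[OF assms(1), of v x] assms(2) by simp

lemma m_inv_Aut:
  assumes "g \<in> carrier Aut"
  shows "m_inv Aut g = inv_into UNIV g"
proof -
  interpret group Aut by (rule group_Aut)
  show ?thesis
    by (rule inv_equality)
       (use assms Aut_inv_closed[OF assms] Aut_bij[OF assms] in
         \<open>auto simp: fun_eq_iff bij_is_surj surj_f_inv_f\<close>)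
qed

lemma Aut_inv_inv:
  assumes "g \<in> carrier Aut"
  shows "inv_into UNIV g (g v) = v" "g (inv_into UNIV g v) = v"
  using Aut_bij[OF assms] by (simp_all add: bij_is_inj bij_is_surj surj_f_inv_f)

text \<open>
  Representatives modulo agreement on a level take the place of the finite quotients of \<open>G\<close>.
\<close>

lemma finite_level_representatives:
  fixes S :: "('x::finite list \<Rightarrow> 'x list) set"
  assumes "S \<subseteq> carrier Aut"
  obtains R where "finite R" "R \<subseteq> S" "\<And>s. s \<in> S \<Longrightarrow> \<exists>r\<in>R. \<forall>y\<in>level m. s y = r y"
    "\<And>r r'. r \<in> R \<Longrightarrow> r' \<in> R \<Longrightarrow> \<forall>y\<in>level m. r y = r' y \<Longrightarrow> r = r'"
proof -
  let ?f = "\<lambda>s. restrict s (level m :: 'x list set)"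
  obtain R where R: "R \<subseteq> S" "inj_on ?f R" "?f ` S = ?f ` R"
    using subset_image_inj[of "?f ` S" ?f S] by auto
  have "?f ` S \<subseteq> level m \<rightarrow>\<^sub>E level m"
    using assms by (auto simp: level_def Aut_length subset_iff split: if_splits)
  hence "finite (?f ` S)"
    using finite_PiE[OF finite_level, of m "\<lambda>_. level m :: 'x list set"] finite_level finite_subset by blast
  hence fin: "finite R" using R finite_image_iff by metis
  show thesis
  proof (rule that[OF fin R(1)])
    fix s assume "s \<in> S"
    hence "?f s \<in> ?f ` R" using R(3) by blast
    then obtain r where r: "r \<in> R" "?f s = ?f r" by auto
    have "s y = r y" if "y \<in> level m" for y using fun_cong[OF r(2), of y] that by simp
    thus "\<exists>r\<in>R. \<forall>y\<in>level m. s y = r y" using r by blast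
  next
    fix r r' assume "r \<in> R" "r' \<in> R" "\<forall>y\<in>level m. r y = r' y"
    thus "r = r'" using R(2) by (auto dest!: inj_onD[where x=r and y=r'] simp: fun_eq_iff)
  qed
qed

text \<open>
  Double counting: a bound on how many of the events can occur together, from below or from above,
  turns into a bound on the sum of their probabilities.
\<close>

lemma (in prob_space) sum_prob_eq_expectation_card:
  assumes "finite I" "\<And>i. i \<in> I \<Longrightarrow> S i \<in> events"
  shows "(\<Sum>i\<in>I. prob (S i)) = expectation (\<lambda>x. real (card {i\<in>I. x \<in> S i}))"
    and "integrable M (\<lambda>x. real (card {i\<in>I. x \<in> S i}))"
proof -
  have eq: "real (card {i\<in>I. x \<in> S i}) = (\<Sum>i\<in>I. indicator (S i) x)" for x
    using assms(1) by (simp add: indicator_def sum.If_cases Int_def)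
  show "integrable M (\<lambda>x. real (card {i\<in>I. x \<in> S i}))"
    unfolding eq using assms
    by (intro Bochner_Integration.integrable_sum integrable_real_indicator) (auto simp: emeasure_eq_measure)
  show "(\<Sum>i\<in>I. prob (S i)) = expectation (\<lambda>x. real (card {i\<in>I. x \<in> S i}))"
    unfolding eq using assms
    by (subst Bochner_Integration.integral_sum) (auto intro!: integrable_real_indicator simp: emeasure_eq_measure)
qed

section \<open>Haar measure and level-determined events\<close>

locale haar_tree_group =
  fixes G :: "('x::finite list \<Rightarrow> 'x list) set" and \<mu> :: "('x list \<Rightarrow> 'x list) measure"
  assumes profinite: "profinite_subgroup G" and haar: "normalized_Haar G \<mu>"
begin

sublocale prob_space \<mu>
  using haar by (simp add: normalized_Haar_def)

lemma subgroup_G: "subgroup G Aut"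
  using profinite by (simp add: profinite_subgroup_def)

lemma G_Aut: "g \<in> G \<Longrightarrow> g \<in> carrier Aut"
  using subgroup.subset[OF subgroup_G] by blast

lemma G_id: "id \<in> G"
  using subgroup.one_closed[OF subgroup_G] by simp

lemma G_comp: "g \<in> G \<Longrightarrow> h \<in> G \<Longrightarrow> h \<circ> g \<in> G"
  using subgroup.m_closed[OF subgroup_G, of g h] by simp

lemma G_inv: "g \<in> G \<Longrightarrow> inv_into UNIV g \<in> G"
  using subgroup.m_inv_closed[OF subgroup_G, of g] by (simp add: m_inv_Aut G_Aut)

lemma space_Haar: "space \<mu> = G"
proof -
  have "space \<mu> = space (sigma G {U. openin (subtopology congruence_topology G) U})"
    using haar by (intro sets_eq_imp_space_eq) (simp add: normalized_Haar_def)
  thus ?thesis by (simp add: space_measure_of_conv)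
qed

lemma opens_subset_Pow: "{U. openin (subtopology congruence_topology G) U} \<subseteq> Pow G"
  by (auto dest: openin_imp_subset)

lemma sets_Haar: "sets \<mu> = sigma_sets G {U. openin (subtopology congruence_topology G) U}"
  using haar opens_subset_Pow by (simp add: normalized_Haar_def)

text \<open>
  Openness relative to \<open>G\<close> asks only for the part of a coset of \<open>St n\<close> that lies in \<open>G\<close>; the
  open subset of the full automorphism group that witnesses it is the union of all these cosets.
\<close>

lemma open_if_level_stable:
  assumes "U \<subseteq> G" "\<And>g. g \<in> U \<Longrightarrow> \<exists>n. \<forall>s\<in>St n. g \<circ> s \<in> G \<longrightarrow> g \<circ> s \<in> U"
  shows "openin (subtopology congruence_topology G) U"
proof -
  let ?V = "{h \<in> carrier Aut. \<exists>g\<in>U. \<exists>n\<ge>1. (\<exists>s\<in>St n. h = g \<circ> s) \<and> (\<forall>s\<in>St n. g \<circ> s \<in> G \<longrightarrow> g \<circ> s \<in> U)}"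
  interpret A: group Aut by (rule group_Aut)
  have St_comp: "s \<circ> t \<in> St n" if "s \<in> St n" "t \<in> St n" for s t :: "'x list \<Rightarrow> 'x list" and n
  proof -
    have "s \<circ> t \<in> carrier Aut" using A.m_closed[of t s] that by (simp add: St_def)
    thus ?thesis using that by (auto simp: St_def)
  qed
  have "openin congruence_topology ?V"
    unfolding openin_congruence_topology
  proof (intro conjI ballI)
    fix h assume "h \<in> ?V"
    then obtain g n s where h: "h \<in> carrier Aut" "g \<in> U" "n \<ge> 1" "s \<in> St n" "h = g \<circ> s"
      "\<forall>s\<in>St n. g \<circ> s \<in> G \<longrightarrow> g \<circ> s \<in> U" by auto
    have "h \<circ> t \<in> ?V" if "t \<in> St n" for t
    proof -
      have "h \<circ> t \<in> carrier Aut" using A.m_closed[of t h] that h(1) by (simp add: St_def)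
      moreover have "h \<circ> t = g \<circ> (s \<circ> t)" using h by (simp add: o_assoc)
      ultimately show ?thesis using h(2,3,6) St_comp[OF h(4) that] by blast
    qed
    thus "\<exists>n\<ge>1. St n #>\<^bsub>Aut\<^esub> h \<subseteq> ?V" using h(3) by (auto simp: r_coset_def intro!: exI[of _ n])
  qed auto
  moreover have "U = ?V \<inter> G"
  proof (intro equalityI subsetI)
    fix g assume g: "g \<in> U"
    obtain n where n: "\<forall>s\<in>St n. g \<circ> s \<in> G \<longrightarrow> g \<circ> s \<in> U" using assms(2)[OF g] by blast
    have "\<forall>s\<in>St (Suc n). g \<circ> s \<in> G \<longrightarrow> g \<circ> s \<in> U"
      using n St_mono[of n "Suc n", where 'a='x] by (simp add: subset_iff)
    moreover have "\<exists>s\<in>St (Suc n). g = g \<circ> s"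
      using G_Aut[OF G_id] by (intro bexI[of _ id]) (auto simp: St_def)
    moreover have "(1::nat) \<le> Suc n" by simp
    ultimately have "\<exists>g'\<in>U. \<exists>n\<ge>1. (\<exists>s\<in>St n. g = g' \<circ> s) \<and> (\<forall>s\<in>St n. g' \<circ> s \<in> G \<longrightarrow> g' \<circ> s \<in> U)"
      using g by blast
    moreover have "g \<in> G" using g assms(1) by blast
    ultimately show "g \<in> ?V \<inter> G" using G_Aut by simp
  qed auto
  ultimately show ?thesis unfolding openin_subtopology by blast
qed

text \<open>
  As the product of \<open>r\<close> and \<open>g\<close> is ``first \<open>r\<close>, then \<open>g\<close>'', left translation by \<open>r\<close> is \<open>g \<mapsto> g \<circ> r\<close>.
  It is continuous because \<open>St n\<close> is normal.
\<close>

lemma translate_measurable: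
  assumes "r \<in> G"
  shows "(\<lambda>g. g \<circ> r) \<in> measurable \<mu> \<mu>"
proof (rule measurable_sigma_sets[OF sets_Haar opens_subset_Pow])
  show "(\<lambda>g. g \<circ> r) \<in> space \<mu> \<rightarrow> G" using assms G_comp by (auto simp: space_Haar)
next
  fix U assume "U \<in> {U. openin (subtopology congruence_topology G) U}"
  then obtain V where V: "openin congruence_topology V" "U = V \<inter> G"
    by (auto simp: openin_subtopology)
  have "openin (subtopology congruence_topology G) ((\<lambda>g. g \<circ> r) -` U \<inter> space \<mu>)"
  proof (rule open_if_level_stable)
    fix g assume "g \<in> (\<lambda>g. g \<circ> r) -` U \<inter> space \<mu>"
    hence g: "g \<circ> r \<in> V" "g \<in> G" by (auto simp: V space_Haar)
    then obtain n where n: "St n #>\<^bsub>Aut\<^esub> (g \<circ> r) \<subseteq> V"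
      using V(1) by (auto simp: openin_congruence_topology)
    have "g \<circ> s \<in> (\<lambda>g. g \<circ> r) -` U \<inter> space \<mu>" if s: "s \<in> St n" "g \<circ> s \<in> G" for s
    proof -
      interpret A: group Aut by (rule group_Aut)
      let ?i = "inv_into UNIV r"
      have r: "r \<in> carrier Aut" "?i \<in> carrier Aut" using assms G_inv G_Aut by auto
      have sA: "s \<in> carrier Aut" using s by (simp add: St_def)
      have "?i \<circ> (s \<circ> r) \<in> carrier Aut"
        using A.m_closed[OF A.m_closed[OF r(1) sA] r(2)] by simp
      hence "?i \<circ> (s \<circ> r) \<in> St n"
        using s Aut_length[OF r(1)] by (auto simp: St_def level_def Aut_inv_inv[OF r(1)])
      hence "(g \<circ> r) \<circ> (?i \<circ> (s \<circ> r)) \<in> V" using n by (auto simp: r_coset_def)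
      moreover have "(g \<circ> r) \<circ> (?i \<circ> (s \<circ> r)) = (g \<circ> s) \<circ> r"
        by (simp add: fun_eq_iff Aut_inv_inv[OF r(1)])
      ultimately have "(g \<circ> s) \<circ> r \<in> V" by simp
      thus ?thesis using s G_comp[OF assms s(2)] by (simp add: V space_Haar)
    qed
    thus "\<exists>n. \<forall>s\<in>St n. g \<circ> s \<in> G \<longrightarrow> g \<circ> s \<in> (\<lambda>g. g \<circ> r) -` U \<inter> space \<mu>" by blast
  qed (auto simp: space_Haar)
  thus "(\<lambda>g. g \<circ> r) -` U \<inter> space \<mu> \<in> sets \<mu>" by (auto simp: sets_Haar)
qed

lemma translate_events:
  assumes "r \<in> G" "A \<in> sets \<mu>"
  shows "{g\<in>G. g \<circ> r \<in> A} \<in> sets \<mu>"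
proof -
  have "{g\<in>G. g \<circ> r \<in> A} = (\<lambda>g. g \<circ> r) -` A \<inter> space \<mu>" by (auto simp: space_Haar)
  thus ?thesis using measurable_sets[OF translate_measurable[OF assms(1)] assms(2)] by simp
qed

lemma emeasure_translate:
  assumes "r \<in> G" "A \<in> sets \<mu>"
  shows "emeasure \<mu> {g\<in>G. g \<circ> r \<in> A} = emeasure \<mu> A"
proof -
  let ?i = "inv_into UNIV r"
  note rA = G_Aut[OF assms(1)]
  have i: "?i \<in> G" by (rule G_inv[OF assms(1)])
  have sub: "A \<subseteq> G" using sets.sets_into_space[OF assms(2)] by (simp add: space_Haar)
  have "{g\<in>G. g \<circ> r \<in> A} = ?i <#\<^bsub>Aut\<^esub> A"
  proof (intro equalityI subsetI)
    fix g assume "g \<in> {g\<in>G. g \<circ> r \<in> A}"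
    hence "g \<circ> r \<in> A" by simp
    thus "g \<in> ?i <#\<^bsub>Aut\<^esub> A" unfolding l_coset_def
      by (intro UN_I[of "g \<circ> r"]) (simp_all add: fun_eq_iff Aut_inv_inv[OF rA])
  next
    fix g assume "g \<in> ?i <#\<^bsub>Aut\<^esub> A"
    then obtain a where a: "a \<in> A" "g = a \<circ> ?i" by (auto simp: l_coset_def)
    have "g \<circ> r = a" using a by (simp add: fun_eq_iff Aut_inv_inv[OF rA])
    moreover have "g \<in> G" unfolding a(2) using a(1) sub by (intro G_comp[OF i]) auto
    ultimately show "g \<in> {g\<in>G. g \<circ> r \<in> A}" using a(1) by simp
  qed
  thus ?thesis using haar i assms by (simp add: normalized_Haar_def)
qed

lemma prob_translate:
  assumes "r \<in> G" "A \<in> sets \<mu>"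
  shows "prob {g\<in>G. g \<circ> r \<in> A} = prob A"
  using emeasure_translate[OF assms] by (simp add: measure_def)

text \<open>
  Finitely many translates of \<open>B\<close> that cover \<open>A\<close> bound the measure of \<open>A\<close>. This is the form in
  which finite index enters: the number of translates plays the role of the index.
\<close>

lemma prob_le_card_mult_of_translates:
  assumes "finite R" "t ` R \<subseteq> G" "B \<in> sets \<mu>" "A \<subseteq> G"
    and "\<And>g. g \<in> A \<Longrightarrow> \<exists>r\<in>R. g \<circ> t r \<in> B"
  shows "prob A \<le> card R * prob B"
proof -
  have ev: "{g\<in>G. g \<circ> t r \<in> B} \<in> sets \<mu>" if "r \<in> R" for r
    using assms that by (intro translate_events) auto
  have "prob A \<le> prob (\<Union>r\<in>R. {g\<in>G. g \<circ> t r \<in> B})"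
    using assms ev by (intro finite_measure_mono) (auto intro!: sets.finite_UN)
  also have "\<dots> \<le> (\<Sum>r\<in>R. prob {g\<in>G. g \<circ> t r \<in> B})"
    using assms ev by (intro measure_UNION_le) auto
  also have "\<dots> = (\<Sum>r\<in>R. prob B)"
    using assms by (intro sum.cong prob_translate) auto
  finally show ?thesis by simp
qed

text \<open>
  The unions of cosets of the stabilizer of level \<open>n\<close> in \<open>G\<close>, that is, the events that are
  decided by the action on level \<open>n\<close>. With growing \<open>n\<close> they form the filtration for the martingale below.
\<close>

definition level_determined :: "nat \<Rightarrow> ('x list \<Rightarrow> 'x list) set \<Rightarrow> bool" where
  "level_determined n A \<longleftrightarrow> A \<subseteq> G \<and> (\<forall>g\<in>A. \<forall>h\<in>G. (\<forall>v\<in>level n. h v = g v) \<longrightarrow> h \<in> A)"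

lemma level_agree_mono:
  assumes "g \<in> G" "h \<in> G" "\<forall>v\<in>level n. h v = g v" "length v \<le> n"
  shows "h v = g v"
proof -
  let ?w = "v @ replicate (n - length v) undefined"
  have "h ?w = g ?w" using assms by (auto simp: level_def)
  hence "take (length v) (h ?w) = take (length v) (g ?w)" by simp
  thus ?thesis by (simp add: Aut_take G_Aut assms)
qed

lemma level_determined_iff:
  assumes "level_determined n A" "g \<in> G" "h \<in> G" "\<forall>v\<in>level n. h v = g v"
  shows "h \<in> A \<longleftrightarrow> g \<in> A"
  using assms unfolding level_determined_def by metis

lemma level_determinedI:
  assumes "A \<subseteq> G"
    and "\<And>g h. g \<in> A \<Longrightarrow> g \<in> G \<Longrightarrow> h \<in> G \<Longrightarrow> (\<And>v. length v \<le> n \<Longrightarrow> h v = g v) \<Longrightarrow> h \<in> A"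
  shows "level_determined n A"
  unfolding level_determined_def
proof (intro conjI ballI impI)
  fix g h assume gh: "g \<in> A" "h \<in> G" "\<forall>v\<in>level n. h v = g v"
  hence g: "g \<in> G" using assms(1) by blast
  show "h \<in> A"
    using gh g by (intro assms(2)[of g h] level_agree_mono) auto
qed (rule assms(1))

lemma level_determined_events:
  assumes "level_determined n A"
  shows "A \<in> sets \<mu>"
proof -
  have "openin (subtopology congruence_topology G) A"
    by (rule open_if_level_stable)
       (use assms in \<open>auto simp: level_determined_def St_def intro!: exI[of _ n]\<close>)
  thus ?thesis by (auto simp: sets_Haar)
qed

lemma translate_level_determined:
  assumes "level_determined n A" "g \<in> G" "t \<in> St n" "t \<in> G"
  shows "g \<circ> t \<in> A \<longleftrightarrow> g \<in> A"
  using assms by (intro level_determined_iff[OF assms(1)] G_comp) (auto simp: St_def)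

end

section \<open>Fixed vertices of one random element\<close>

locale super_strongly_fractal_group = haar_tree_group +
  assumes ssf: "super_strongly_fractal G"
begin

lemma section_in_G: "g \<in> G \<Longrightarrow> section_at g v \<in> G"
  using ssf by (simp add: super_strongly_fractal_def self_similar_def)

text \<open>
  How the surjectivity of the section maps is applied: translating by \<open>t\<close> leaves every event
  determined by level \<open>n\<close> unchanged and multiplies the section at \<open>v\<close> by a prescribed element.
\<close>

lemma stabilizer_with_section:
  assumes "v \<in> level n" "s \<in> G"
  obtains t where "t \<in> St n" "t \<in> G" "section_at t v = s"
proof (cases "n = 0")
  case True
  hence "s \<in> St n" "section_at s v = s"
    using assms G_Aut[OF assms(2)] by (auto simp: St_def level_def section_at_def Aut_Nil)
  thus ?thesis using that assms by blast
next
  case False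
  hence "(\<lambda>g. section_at g v) ` (St n \<inter> G) = G"
    using ssf assms by (simp add: super_strongly_fractal_def)
  hence "s \<in> (\<lambda>g. section_at g v) ` (St n \<inter> G)" using assms(2) by simp
  then obtain t where "s = section_at t v" "t \<in> St n \<inter> G" by (rule imageE)
  thus ?thesis using that[of t] by simp
qed

lemma transitive_on_level:
  assumes "x \<in> level n" "y \<in> level n"
  obtains s where "s \<in> G" "s x = y"
proof (cases "n = 0")
  case True
  thus ?thesis using that[OF G_id] assms by (simp add: level_def)
next
  case False
  have "\<forall>n\<ge>1. \<forall>u\<in>level n. \<forall>v\<in>level n. \<exists>g\<in>G. g u = v"
    using ssf unfolding super_strongly_fractal_def level_transitive_def by (elim conjE)
  moreover have "n \<ge> 1" using False by simp
  ultimately show ?thesis using that assms by blast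
qed

text \<open>
  Split the event that \<open>v\<close> is fixed according to which \<open>v @ y\<close> is sent to \<open>v @ x\<close>. The pieces have
  equal probability: the translation by an element that fixes level \<open>n\<close> and whose section at \<open>v\<close>
  sends \<open>x\<close> to \<open>y\<close> carries the piece of \<open>y\<close> to that of \<open>x\<close>.
\<close>

lemma prob_fixes_descendant:
  assumes "level_determined n A" "v \<in> level n" "x \<in> level j"
  shows "prob {g\<in>A. g v = v} = CARD('a) ^ j * prob {g\<in>A. g (v @ x) = v @ x}"
proof -
  have AG: "A \<subseteq> G" using assms(1) by (simp add: level_determined_def)
  define S where "S = (\<lambda>y. {g\<in>A. g v = v \<and> g (v @ y) = v @ x})"
  have ev: "S y \<in> sets \<mu>" if "y \<in> level j" for y
  proof (rule level_determined_events[of "n + j"], rule level_determinedI)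
    fix g h assume g: "g \<in> S y" "g \<in> G" "h \<in> G" "\<And>w. length w \<le> n + j \<Longrightarrow> h w = g w"
    moreover have "h \<in> A"
      using g by (subst level_determined_iff[OF assms(1), of g h]) (auto simp: S_def level_def)
    ultimately show "h \<in> S y" using assms that by (auto simp: S_def level_def)
  qed (use AG in \<open>auto simp: S_def\<close>)
  have same: "prob (S y) = prob (S x)" if y: "y \<in> level j" for y
  proof -
    obtain s where s: "s \<in> G" "s x = y" using transitive_on_level assms(3) y by metis
    obtain t where t: "t \<in> St n" "t \<in> G" "section_at t v = s"
      using stabilizer_with_section[OF assms(2) s(1)] .
    have tv: "t v = v" using t assms(2) by (auto simp: St_def)
    have tx: "t (v @ x) = v @ y" using section_at_append[OF G_Aut[OF t(2)], of v x] t tv s by simp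
    have "{g\<in>G. g \<circ> t \<in> S x} = S y"
      using AG translate_level_determined[OF assms(1) _ t(1,2)] by (auto simp: S_def tv tx)
    thus ?thesis using prob_translate[OF t(2) ev[OF assms(3)]] by simp
  qed
  have "{g\<in>A. g v = v} = (\<Union>y\<in>level j. S y)"
  proof (intro equalityI subsetI)
    fix g assume g: "g \<in> {g\<in>A. g v = v}"
    hence gA: "g \<in> carrier Aut" using AG G_Aut by auto
    let ?z = "inv_into UNIV g (v @ x)"
    have "g ?z = v @ x" by (rule Aut_inv_inv[OF gA])
    moreover have "take (length v) ?z = v"
    proof -
      have "g (take (length v) ?z) = g v"
        using Aut_take[OF gA, of "length v" ?z] g Aut_inv_inv(2)[OF gA, of "v @ x"] by simp
      thus ?thesis using Aut_bij[OF gA] by (meson bij_is_inj injD)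
    qed
    moreover have "length ?z = length v + j"
      using Aut_length[OF gA, of ?z] assms(3) Aut_inv_inv(2)[OF gA, of "v @ x"] by (simp add: level_def)
    ultimately have "drop (length v) ?z \<in> level j" "g (v @ drop (length v) ?z) = v @ x"
      by (simp_all add: level_def) (metis append_take_drop_id)
    thus "g \<in> (\<Union>y\<in>level j. S y)" using g by (auto simp: S_def)
  qed (auto simp: S_def)
  moreover have "disjoint_family_on S (level j)"
    unfolding disjoint_family_on_def
  proof (intro ballI impI)
    fix y y' :: "'a list" assume "y \<noteq> y'"
    show "S y \<inter> S y' = {}"
    proof (rule ccontr)
      assume "S y \<inter> S y' \<noteq> {}"
      then obtain g where g: "g \<in> S y" "g \<in> S y'" by blast
      hence "g (v @ y) = g (v @ y')" "g \<in> carrier Aut" using AG G_Aut by (auto simp: S_def)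
      thus False using \<open>y \<noteq> y'\<close> Aut_bij by (metis bij_is_inj injD same_append_eq)
    qed
  qed
  ultimately have "prob {g\<in>A. g v = v} = (\<Sum>y\<in>level j. prob (S y))"
    using finite_measure_finite_Union[OF finite_level, of S j] ev by auto
  also have "\<dots> = CARD('a) ^ j * prob (S x)" using same by (simp add: card_level)
  also have "S x = {g\<in>A. g (v @ x) = v @ x}"
  proof -
    have "g v = v" if "g \<in> A" "g (v @ x) = v @ x" for g
      using Aut_take[of g "length v" "v @ x"] that AG G_Aut by auto
    thus ?thesis by (auto simp: S_def)
  qed
  finally show ?thesis .
qed

definition num_fixed :: "nat \<Rightarrow> ('a list \<Rightarrow> 'a list) \<Rightarrow> nat" where
  "num_fixed n g = card {v\<in>level n. g v = v}"

lemma fixing_events: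
  assumes "level_determined n A"
  shows "{g\<in>A. g v = v} \<in> sets \<mu>"
proof (rule level_determined_events[of "n + length v"], rule level_determinedI)
  fix g h assume g: "g \<in> {g\<in>A. g v = v}" "g \<in> G" "h \<in> G" "\<And>w. length w \<le> n + length v \<Longrightarrow> h w = g w"
  moreover have "h \<in> A"
    using g by (subst level_determined_iff[OF assms(1), of g h]) (auto simp: level_def)
  ultimately show "h \<in> {g\<in>A. g v = v}" by auto
qed (use assms in \<open>auto simp: level_determined_def\<close>)

text \<open>
  The sum on the right is the integral over \<open>A\<close> of the number of fixed vertices of level \<open>n\<close>, so
  this is the martingale property of that number.
\<close>

lemma sum_prob_fixed_martingale:
  assumes "level_determined n A"
  shows "(\<Sum>v\<in>level (n + j). prob {g\<in>A. g v = v}) = (\<Sum>v\<in>level n. prob {g\<in>A. g v = v})"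
proof -
  have "bij_betw (\<lambda>(v, x). v @ x) (level n \<times> level j) (level (n + j) :: 'a list set)"
  proof (rule bij_betw_imageI)
    show "inj_on (\<lambda>(v, x). v @ x) (level n \<times> level j :: ('a list \<times> 'a list) set)"
      by (auto simp: inj_on_def level_def)
    have "w \<in> (\<lambda>(v, x). v @ x) ` (level n \<times> level j)" if "w \<in> level (n + j)" for w :: "'a list"
      by (rule image_eqI[of _ _ "(take n w, drop n w)"]) (use that in \<open>auto simp: level_def\<close>)
    thus "(\<lambda>(v, x). v @ x) ` (level n \<times> level j) = (level (n + j) :: 'a list set)"
      by (auto simp: level_def)
  qed
  hence "(\<Sum>v\<in>level (n + j). prob {g\<in>A. g v = v})
        = (\<Sum>(v, x)\<in>level n \<times> level j. prob {g\<in>A. g (v @ x) = v @ x})"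
    by (subst sum.reindex_bij_betw[symmetric]) (auto simp: case_prod_unfold)
  also have "\<dots> = (\<Sum>v\<in>level n. \<Sum>x\<in>level j. prob {g\<in>A. g (v @ x) = v @ x})"
    by (simp add: sum.cartesian_product)
  also have "\<dots> = (\<Sum>v\<in>level n. \<Sum>x\<in>(level j :: 'a list set). prob {g\<in>A. g v = v} / CARD('a) ^ j)"
  proof (intro sum.cong refl)
    fix v x :: "'a list" assume "v \<in> level n" "x \<in> level j"
    thus "prob {g\<in>A. g (v @ x) = v @ x} = prob {g\<in>A. g v = v} / CARD('a) ^ j"
      using prob_fixes_descendant[OF assms, of v x j] by simp
  qed
  also have "\<dots> = (\<Sum>v\<in>level n. prob {g\<in>A. g v = v})"
    by (simp add: card_level)
  finally show ?thesis .
qed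

lemma prob_le_sum_prob_fixed:
  assumes "level_determined n A" "\<And>g. g \<in> A \<Longrightarrow> c \<le> num_fixed n g"
  shows "c * prob A \<le> (\<Sum>v\<in>level n. prob {g\<in>A. g v = v})"
proof -
  note sp = sum_prob_eq_expectation_card[of "level n" "\<lambda>v. {g\<in>A. g v = v}",
      OF finite_level fixing_events[OF assms(1)], simplified mem_Collect_eq]
  have AE: "A \<in> sets \<mu>" by (rule level_determined_events[OF assms(1)])
  have "c * prob A = expectation (\<lambda>g. real c * indicator A g)"
    using AE by simp
  also have "\<dots> \<le> expectation (\<lambda>g. real (card {v\<in>level n. g \<in> A \<and> g v = v}))"
  proof (rule integral_mono[OF _ sp(2)])
    show "integrable \<mu> (\<lambda>g. real c * indicator A g)"
      using AE by (intro integrable_mult_right integrable_real_indicator) (auto simp: emeasure_eq_measure)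
  qed (use assms(2) in \<open>auto simp: indicator_def num_fixed_def\<close>)
  finally show ?thesis using sp(1) by simp
qed

lemma level_determined_num_fixed:
  "level_determined n {g\<in>G. \<forall>i\<le>n. P i (num_fixed i g)}"
proof (rule level_determinedI)
  fix g h assume g: "g \<in> {g\<in>G. \<forall>i\<le>n. P i (num_fixed i g)}" "h \<in> G" "\<And>w. length w \<le> n \<Longrightarrow> h w = g w"
  have "num_fixed i h = num_fixed i g" if "i \<le> n" for i
    unfolding num_fixed_def using g(3) that by (intro arg_cong[where f = card]) (auto simp: level_def)
  thus "h \<in> {g\<in>G. \<forall>i\<le>n. P i (num_fixed i g)}" using g(1,2) by simp
qed auto

lemma num_fixed_events: "{g\<in>G. P (num_fixed n g)} \<in> sets \<mu>"
proof -
  have "{g\<in>G. P (num_fixed n g)} = {g\<in>G. \<forall>i\<le>n. i = n \<longrightarrow> P (num_fixed i g)}" by auto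
  thus ?thesis
    using level_determined_events[OF level_determined_num_fixed[of n "\<lambda>i x. i = n \<longrightarrow> P x"]] by simp
qed

text \<open>
  Doob's maximal inequality for the martingale \<open>num_fixed\<close>, whose mean is its value 1 at the root.
  The event is cut into the parts \<open>C i\<close> on which \<open>M\<close> is reached at level \<open>i\<close> for the first time.
\<close>

lemma num_fixed_maximal_inequality:
  "M * prob {g\<in>G. \<exists>i\<le>n. M \<le> num_fixed i g} \<le> 1"
proof -
  define C where "C = (\<lambda>i. {g\<in>G. M \<le> num_fixed i g \<and> (\<forall>l<i. num_fixed l g < M)})"
  have C: "level_determined i (C i)" for i
  proof -
    have "C i = {g\<in>G. \<forall>l\<le>i. if l = i then M \<le> num_fixed l g else num_fixed l g < M}"
      by (auto simp: C_def)
    thus ?thesis using level_determined_num_fixed[of i "\<lambda>l x. if l = i then M \<le> x else x < M"] by simp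
  qed
  have disj: "disjoint_family_on C I" for I
    unfolding disjoint_family_on_def
  proof (intro ballI impI)
    fix i l :: nat assume "i \<noteq> l"
    hence "i < l \<or> l < i" by auto
    hence "g \<notin> C l" if "g \<in> C i" for g
      using that unfolding C_def by (metis (mono_tags, lifting) leD mem_Collect_eq)
    thus "C i \<inter> C l = {}" by blast
  qed
  have Cev: "C i \<in> sets \<mu>" for i using C level_determined_events by blast
  have U: "{g\<in>G. \<exists>i\<le>n. M \<le> num_fixed i g} = (\<Union>i\<le>n. C i)"
  proof (intro equalityI subsetI)
    fix g assume g: "g \<in> {g\<in>G. \<exists>i\<le>n. M \<le> num_fixed i g}"
    then obtain i where i: "i \<le> n" "M \<le> num_fixed i g" by blast
    define k where "k = (LEAST i. M \<le> num_fixed i g)"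
    have "k \<le> i" "M \<le> num_fixed k g" "\<forall>l<k. num_fixed l g < M"
      unfolding k_def using i(2) by (auto intro: Least_le LeastI dest: not_less_Least)
    thus "g \<in> (\<Union>i\<le>n. C i)" using g i by (auto simp: C_def)
  qed (auto simp: C_def)
  have G0: "level_determined 0 G" by (rule level_determinedI) auto
  have "M * prob {g\<in>G. \<exists>i\<le>n. M \<le> num_fixed i g} = (\<Sum>i\<le>n. M * prob (C i))"
    using disj Cev by (simp add: U finite_measure_finite_Union image_subset_iff sum_distrib_left)
  also have "\<dots> \<le> (\<Sum>i\<le>n. \<Sum>v\<in>level i. prob {g\<in>C i. g v = v})"
    by (intro sum_mono prob_le_sum_prob_fixed C) (auto simp: C_def)
  also have "\<dots> = (\<Sum>i\<le>n. \<Sum>v\<in>level n. prob {g\<in>C i. g v = v})"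
  proof (rule sum.cong[OF refl])
    fix i assume "i \<in> {..n}"
    thus "(\<Sum>v\<in>level i. prob {g\<in>C i. g v = v}) = (\<Sum>v\<in>level n. prob {g\<in>C i. g v = v})"
      using sum_prob_fixed_martingale[OF C, of i "n - i"] by simp
  qed
  also have "\<dots> = (\<Sum>v\<in>level n. \<Sum>i\<le>n. prob {g\<in>C i. g v = v})" by (rule sum.swap)
  also have "\<dots> \<le> (\<Sum>v\<in>level n. prob {g\<in>G. g v = v})"
  proof (rule sum_mono)
    fix v :: "'a list"
    have "disjoint_family_on (\<lambda>i. {g\<in>C i. g v = v}) {..n}"
      using disj[of "{..n}"] by (auto simp: disjoint_family_on_def)
    hence "(\<Sum>i\<le>n. prob {g\<in>C i. g v = v}) = prob (\<Union>i\<le>n. {g\<in>C i. g v = v})"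
      using fixing_events[OF C] by (subst finite_measure_finite_Union) auto
    also have "\<dots> \<le> prob {g\<in>G. g v = v}"
      by (rule finite_measure_mono) (auto simp: C_def intro!: fixing_events[OF G0])
    finally show "(\<Sum>i\<le>n. prob {g\<in>C i. g v = v}) \<le> prob {g\<in>G. g v = v}" .
  qed
  also have "\<dots> = (\<Sum>v\<in>level 0. prob {g\<in>G. g v = v})"
    using sum_prob_fixed_martingale[OF G0, of n] by simp
  also have "\<dots> \<le> 1"
    by (simp add: level_def)
  finally show ?thesis .
qed

text \<open>
  The constant \<open>K\<close> depends on \<open>j\<close> only, which is what makes repeated application effective. It is the
  number of actions of \<open>G\<close> on level \<open>j\<close>: whatever the section of \<open>g\<close> at a fixed vertex does there, one of
  \<open>K\<close> translations within the stabilizer of level \<open>n\<close> makes it trivial on level \<open>j\<close>, and then all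
  descendants of that vertex on the next \<open>j\<close> levels are fixed.
\<close>

lemma explosion:
  obtains K :: nat where "\<And>n A. level_determined n A \<Longrightarrow> (\<And>g. g \<in> A \<Longrightarrow> \<exists>v\<in>level n. g v = v) \<Longrightarrow>
     prob A \<le> K * prob {g\<in>A. CARD('a) ^ j \<le> num_fixed (n + j) g}"
proof -
  obtain R where R: "finite R" "R \<subseteq> G" "\<And>s. s \<in> G \<Longrightarrow> \<exists>r\<in>R. \<forall>y\<in>level j. s y = r y"
    using finite_level_representatives[of G j] G_Aut by (metis subsetI)
  have local: "prob A \<le> card R * prob {g\<in>A. \<forall>y\<in>level j. g (v @ y) = v @ y}"
    if A: "level_determined n A" and v: "v \<in> level n" and fix_v: "\<And>g. g \<in> A \<Longrightarrow> g v = v" for n A v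
  proof -
    have AG: "A \<subseteq> G" using A by (simp add: level_determined_def)
    have "\<exists>t. t \<in> St n \<and> t \<in> G \<and> section_at t v = inv_into UNIV r" if "r \<in> R" for r
      using stabilizer_with_section[OF v, of "inv_into UNIV r"] G_inv R(2) that by blast
    then obtain t where t: "\<And>r. r \<in> R \<Longrightarrow> t r \<in> St n \<and> t r \<in> G \<and> section_at (t r) v = inv_into UNIV r"
      by metis
    let ?B = "{g\<in>A. \<forall>y\<in>level j. g (v @ y) = v @ y}"
    show ?thesis
    proof (rule prob_le_card_mult_of_translates[OF R(1), of t])
      show "t ` R \<subseteq> G" using t by blast
      show "?B \<in> sets \<mu>"
      proof (rule level_determined_events[of "n + j"], rule level_determinedI)
        fix g h assume g: "g \<in> ?B" "g \<in> G" "h \<in> G" "\<And>w. length w \<le> n + j \<Longrightarrow> h w = g w"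
        moreover have "h \<in> A"
          using g by (subst level_determined_iff[OF A, of g h]) (auto simp: level_def)
        ultimately show "h \<in> ?B" using v by (auto simp: level_def)
      qed (use AG in auto)
      fix g assume g: "g \<in> A"
      obtain r where r: "r \<in> R" "\<forall>y\<in>level j. section_at g v y = r y"
        using R(3) section_in_G g AG by blast
      have rA: "r \<in> carrier Aut" using r R(2) G_Aut by blast
      have "g \<circ> t r \<in> ?B"
      proof (intro CollectI conjI ballI)
        show "g \<circ> t r \<in> A" using translate_level_determined[OF A] g AG t r by blast
        fix y :: "'a list" assume y: "y \<in> level j"
        have tv: "t r v = v" using t r v by (auto simp: St_def)
        have "t r (v @ y) = v @ inv_into UNIV r y"
          using section_at_append[of "t r" v y] tv t[OF r(1)] G_Aut by simp
        moreover have "g (v @ inv_into UNIV r y) = v @ section_at g v (inv_into UNIV r y)"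
          using section_at_append[of g v "inv_into UNIV r y"] fix_v[OF g] g AG G_Aut by auto
        moreover have "inv_into UNIV r y \<in> level j"
          using Aut_length[OF Aut_inv_closed[OF rA]] y by (simp add: level_def)
        ultimately show "(g \<circ> t r) (v @ y) = v @ y" using r(2) by (simp add: Aut_inv_inv[OF rA])
      qed
      thus "\<exists>r\<in>R. g \<circ> t r \<in> ?B" using r by blast
    qed (rule AG)
  qed
  show thesis
  proof (rule that)
    fix n A assume A: "level_determined n A" and ex: "\<And>g. g \<in> A \<Longrightarrow> \<exists>v\<in>level n. g v = v"
    have AG: "A \<subseteq> G" using A by (simp add: level_determined_def)
    \<comment> \<open>Split \<open>A\<close> by a choice of fixed vertex that depends on the action on level \<open>n\<close> only.\<close>
    define f where "f = (\<lambda>g :: 'a list \<Rightarrow> 'a list. SOME v. v \<in> level n \<and> g v = v)"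
    have f: "f g \<in> level n" "g (f g) = f g" if "g \<in> A" for g
      using someI_ex[of "\<lambda>v. v \<in> level n \<and> g v = v"] ex[OF that] by (auto simp: f_def)
    define Av where "Av = (\<lambda>v. {g\<in>A. f g = v})"
    have Av: "level_determined n (Av v)" for v
    proof (rule level_determinedI)
      fix g h assume g: "g \<in> Av v" "g \<in> G" "h \<in> G" "\<And>w. length w \<le> n \<Longrightarrow> h w = g w"
      have "h \<in> A"
        using g by (subst level_determined_iff[OF A, of g h]) (auto simp: level_def Av_def)
      moreover have "f h = f g" unfolding f_def using g(4) by (intro arg_cong[where f = Eps]) (auto simp: level_def)
      ultimately show "h \<in> Av v" using g by (simp add: Av_def)
    qed (use AG in \<open>auto simp: Av_def\<close>)
    let ?E = "\<lambda>v. {g\<in>Av v. CARD('a) ^ j \<le> num_fixed (n + j) g}"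
    have E: "?E v \<in> sets \<mu>" for v
    proof -
      have "?E v = Av v \<inter> {g\<in>G. CARD('a) ^ j \<le> num_fixed (n + j) g}"
        using AG by (auto simp: Av_def)
      thus ?thesis
        using level_determined_events[OF Av] num_fixed_events[of "\<lambda>x. CARD('a) ^ j \<le> x"] by auto
    qed
    have many: "CARD('a) ^ j \<le> num_fixed (n + j) g"
      if "v \<in> level n" "\<forall>y\<in>level j. g (v @ y) = v @ y" for g v
    proof -
      have "card ((\<lambda>y. v @ y) ` (level j :: 'a list set)) \<le> num_fixed (n + j) g"
        unfolding num_fixed_def using that
        by (intro card_mono) (auto simp: level_def intro: finite_subset[OF _ finite_level[of "n + j"]])
      moreover have "inj_on (\<lambda>y. v @ y) (level j)" by (simp add: inj_on_def)
      ultimately show ?thesis by (simp add: card_image card_level)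
    qed
    have "A = (\<Union>v\<in>level n. Av v)" using f by (auto simp: Av_def)
    hence "prob A \<le> (\<Sum>v\<in>level n. prob (Av v))"
      using level_determined_events[OF Av] finite_level by (metis measure_UNION_le)
    also have "\<dots> \<le> (\<Sum>v\<in>level n. card R * prob (?E v))"
    proof (rule sum_mono)
      fix v :: "'a list" assume v: "v \<in> level n"
      have "prob (Av v) \<le> card R * prob {g\<in>Av v. \<forall>y\<in>level j. g (v @ y) = v @ y}"
        by (rule local[OF Av v]) (use f in \<open>auto simp: Av_def\<close>)
      also have "\<dots> \<le> card R * prob (?E v)"
        using many[OF v] E by (intro mult_left_mono finite_measure_mono) auto
      finally show "prob (Av v) \<le> card R * prob (?E v)" .
    qed
    also have "\<dots> = card R * prob (\<Union>v\<in>level n. ?E v)"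
      using E finite_level by (subst finite_measure_finite_Union) (auto simp: disjoint_family_on_def Av_def sum_distrib_left)
    also have "(\<Union>v\<in>level n. ?E v) = {g\<in>A. CARD('a) ^ j \<le> num_fixed (n + j) g}"
      using f by (auto simp: Av_def)
    finally show "prob A \<le> card R * prob {g\<in>A. CARD('a) ^ j \<le> num_fixed (n + j) g}" .
  qed
qed

definition fixing :: "nat \<Rightarrow> ('a list \<Rightarrow> 'a list) set" where
  "fixing m = {g\<in>G. \<exists>v\<in>level m. g v = v}"

lemma num_fixed_pos_iff: "0 < num_fixed n g \<longleftrightarrow> (\<exists>v\<in>level n. g v = v)"
  by (auto simp: num_fixed_def card_gt_0_iff finite_level)

lemma fixing_level_determined: "level_determined m (fixing m)"
  by (rule level_determinedI) (auto simp: fixing_def level_def)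

lemma num_fixed_pos_mono:
  assumes "g \<in> G" "i \<le> n" "0 < num_fixed n g"
  shows "0 < num_fixed i g"
proof -
  obtain v where v: "v \<in> level n" "g v = v" using assms by (auto simp: num_fixed_pos_iff)
  have "g (take i v) = take i v" using Aut_take[OF G_Aut[OF assms(1)], of i v] v by simp
  moreover have "take i v \<in> level i" using v assms(2) by (simp add: level_def)
  ultimately show ?thesis unfolding num_fixed_pos_iff by blast
qed

text \<open>
  Elements with a fixed vertex on level \<open>n\<close> have a fixed vertex on every earlier level, so their
  number of fixed vertices either reached \<open>M\<close> before, which has probability at most \<open>1 / M\<close>, or stayed
  strictly between 0 and \<open>M\<close> all along. The latter has exponentially small probability: in each
  block of \<open>j\<close> levels, a proportion of at least \<open>1 / (K + 1)\<close> jumps above \<open>M\<close>.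
\<close>

lemma prob_fixing_arbitrarily_small:
  assumes "CARD('a) \<ge> 2" "\<epsilon> > 0"
  shows "\<exists>m. prob (fixing m) < \<epsilon>"
proof -
  obtain M :: nat where M: "M > 0" "1 / M < \<epsilon> / 2"
    using assms(2) by (metis ex_inverse_of_nat_less half_gt_zero inverse_eq_divide)
  obtain j :: nat where "M < 2 ^ j" using less_exp by blast
  hence j: "M < CARD('a) ^ j" using power_mono[of 2 "CARD('a)" j] assms(1) by linarith
  obtain K :: nat where K: "\<And>n A. level_determined n A \<Longrightarrow> (\<And>g. g \<in> A \<Longrightarrow> \<exists>v\<in>level n. g v = v) \<Longrightarrow>
     prob A \<le> K * prob {g\<in>A. CARD('a) ^ j \<le> num_fixed (n + j) g}" using explosion[of j] by blast
  define B where "B = (\<lambda>n. {g\<in>G. \<forall>i\<le>n. 0 < num_fixed i g \<and> num_fixed i g < M})"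
  have B: "level_determined n (B n)" for n
    unfolding B_def by (rule level_determined_num_fixed[where P = "\<lambda>i x. 0 < x \<and> x < M"])
  \<comment> \<open>\<open>K + 1\<close> instead of \<open>K\<close> makes the quotient meaningful without knowing that \<open>K\<close> is positive.\<close>
  define c :: real where "c = 1 - 1 / (K + 1)"
  have c: "0 \<le> c" "c < 1" by (auto simp: c_def)
  have step: "prob (B (n + j)) \<le> c * prob (B n)" for n
  proof -
    let ?E = "{g\<in>B n. CARD('a) ^ j \<le> num_fixed (n + j) g}"
    have "?E = B n \<inter> {g\<in>G. CARD('a) ^ j \<le> num_fixed (n + j) g}"
      by (auto simp: B_def)
    hence Eev: "?E \<in> sets \<mu>"
      using level_determined_events[OF B] num_fixed_events[of "\<lambda>x. CARD('a) ^ j \<le> x"] by auto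
    have "prob (B n) \<le> K * prob ?E"
      by (rule K[OF B]) (auto simp: B_def num_fixed_pos_iff)
    also have "\<dots> \<le> (K + 1) * prob ?E" by (simp add: distrib_right)
    finally have "prob (B n) / (K + 1) \<le> prob ?E" by (simp add: divide_le_eq mult.commute)
    moreover have "prob (B (n + j)) + prob ?E \<le> prob (B n)"
    proof -
      have "B (n + j) \<inter> ?E = {}" using j by (auto simp: B_def)
      hence "prob (B (n + j)) + prob ?E = prob (B (n + j) \<union> ?E)"
        using Eev level_determined_events[OF B] by (intro finite_measure_Union[symmetric]) auto
      also have "\<dots> \<le> prob (B n)"
      proof (rule finite_measure_mono[OF _ level_determined_events[OF B]])
        show "B (n + j) \<union> ?E \<subseteq> B n" unfolding B_def using trans_le_add1 by blast
      qed
      finally show ?thesis .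
    qed
    ultimately show ?thesis by (simp add: c_def left_diff_distrib)
  qed
  have pow: "prob (B (i * j)) \<le> c ^ i" for i
  proof (induction i)
    case (Suc i)
    have "prob (B (Suc i * j)) \<le> c * prob (B (i * j))" using step[of "i * j"] by (simp add: add.commute)
    also have "\<dots> \<le> c * c ^ i" using Suc c by (intro mult_left_mono) auto
    finally show ?case by simp
  qed simp
  obtain i where i: "c ^ i < \<epsilon> / 2" using real_arch_pow_inv[of "\<epsilon> / 2" c] c assms(2) by auto
  define n where "n = i * j"
  let ?H = "{g\<in>G. \<exists>i\<le>n. M \<le> num_fixed i g}"
  have Hev: "?H \<in> sets \<mu>"
  proof -
    have eq: "?H = space \<mu> - {g\<in>G. \<forall>i\<le>n. num_fixed i g < M}" by (auto simp: not_less space_Haar)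
    show ?thesis unfolding eq
      by (rule sets.compl_sets[OF level_determined_events[OF level_determined_num_fixed[where P = "\<lambda>_ x. x < M"]]])
  qed
  have "fixing n \<subseteq> B n \<union> ?H"
  proof
    fix g assume g: "g \<in> fixing n"
    hence gG: "g \<in> G" and pos: "0 < num_fixed n g" by (auto simp: fixing_def num_fixed_pos_iff)
    have "\<forall>l\<le>n. 0 < num_fixed l g" by (intro allI impI num_fixed_pos_mono[OF gG _ pos])
    thus "g \<in> B n \<union> ?H" using gG by (cases "\<exists>l\<le>n. M \<le> num_fixed l g") (auto simp: B_def not_le)
  qed
  hence "prob (fixing n) \<le> prob (B n \<union> ?H)"
    by (rule finite_measure_mono[OF _ sets.Un[OF level_determined_events[OF B] Hev]])
  also have "\<dots> \<le> prob (B n) + prob ?H"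
    by (rule measure_Un_le[OF level_determined_events[OF B] Hev])
  also have "\<dots> < \<epsilon> / 2 + \<epsilon> / 2"
  proof (intro add_le_less_mono)
    show "prob (B n) \<le> \<epsilon> / 2" using pow[of i] i by (simp add: n_def)
    have "prob ?H \<le> 1 / M" using num_fixed_maximal_inequality[of M n] M(1) by (simp add: field_simps)
    thus "prob ?H < \<epsilon> / 2" using M(2) by simp
  qed
  finally show ?thesis by auto
qed

end

section \<open>Averaging over rigid stabilizers\<close>

text \<open>
  The root \<open>v\<close> of the moving subtree is fixed as well, because all other vertices of its level are.
\<close>

lemma rist_length_fixed:
  assumes "r \<in> rist G v" "G \<subseteq> carrier Aut" "length w = length v"
  shows "r w = w"
proof (cases "w = v")
  case True
  have r: "r \<in> carrier Aut" "\<And>w. \<not> prefix v w \<Longrightarrow> r w = w" using assms by (auto simp: rist_def)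
  have "r v = v"
  proof (rule ccontr)
    assume ne: "r v \<noteq> v"
    hence "\<not> prefix v (r v)" using Aut_length[OF r(1), of v] by (auto simp: prefix_def)
    hence "r (r v) = r v" by (rule r(2))
    thus False using ne Aut_bij[OF r(1)] by (meson bij_is_inj injD)
  qed
  thus ?thesis using True by simp
next
  case False
  hence "\<not> prefix v w" using assms(3) by (auto simp: prefix_def)
  thus ?thesis using assms(1) by (simp add: rist_def)
qed

locale super_strongly_fractal_branch_group = super_strongly_fractal_group +
  assumes branch_G: "branch G"
begin

lemma ristD: "r \<in> rist G u \<Longrightarrow> r \<in> G" "r \<in> rist G u \<Longrightarrow> r u = u"
  using rist_length_fixed[of r G u u] G_Aut by (auto simp: rist_def)

lemma rist_id: "id \<in> rist G u"
  using G_id by (simp add: rist_def)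

lemma rist_comp: "r \<in> rist G u \<Longrightarrow> s \<in> rist G u \<Longrightarrow> s \<circ> r \<in> rist G u"
  using G_comp by (simp add: rist_def)

lemma rist_inv:
  assumes "r \<in> rist G u"
  shows "inv_into UNIV r \<in> rist G u"
proof -
  have r: "r \<in> G" "\<And>w. \<not> prefix u w \<Longrightarrow> r w = w" using assms by (auto simp: rist_def)
  have "inv_into UNIV r w = w" if "\<not> prefix u w" for w
    using Aut_inv_inv(1)[OF G_Aut[OF r(1)], of w] r(2)[OF that] by simp
  thus ?thesis using G_inv[OF r(1)] by (simp add: rist_def)
qed

text \<open>
  Below \<open>u\<close>, the generators from other rigid stabilizers act trivially, so \<open>Rist\<close> and the rigid
  stabilizer of \<open>u\<close> have the same sections at \<open>u\<close>.
\<close>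

lemma Rist_acts_as_rist:
  assumes "\<rho> \<in> Rist G n" "u \<in> level n"
  shows "\<rho> \<in> G \<inter> St n \<and> (\<exists>r\<in>rist G u. \<forall>y. \<rho> (u @ y) = r (u @ y))"
  using assms(1) unfolding Rist_def
proof (induction rule: generate.induct)
  case one
  have "(id :: 'a list \<Rightarrow> 'a list) \<in> St n" using G_Aut[OF G_id] by (simp add: St_def)
  thus ?case unfolding Aut_sel using G_id rist_id by blast
next
  have rist: "h \<in> G \<inter> St n \<and> (\<exists>r\<in>rist G u. \<forall>y. h (u @ y) = r (u @ y))"
    if h: "h \<in> rist G v" and v: "v \<in> level n" for h v
  proof -
    have "h w = w" if "w \<in> level n" for w
      using rist_length_fixed[OF h, of w] G_Aut v that by (auto simp: level_def)
    hence "h \<in> G \<inter> St n" using ristD(1)[OF h] G_Aut by (auto simp: St_def)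
    moreover have "\<exists>r\<in>rist G u. \<forall>y. h (u @ y) = r (u @ y)"
    proof (cases "u = v")
      case False
      have "\<not> prefix v (u @ y)" for y
      proof
        assume "prefix v (u @ y)"
        then obtain z where "u @ y = v @ z" by (auto simp: prefix_def)
        moreover have "length u = length v" using v assms(2) by (simp add: level_def)
        ultimately show False using False by simp
      qed
      hence "\<forall>y. h (u @ y) = id (u @ y)" using h by (simp add: rist_def)
      thus ?thesis using rist_id by blast
    qed (use h in blast)
    ultimately show ?thesis by blast
  qed
  { case (incl h) thus ?case using rist by blast }
  { case (inv h)
    then obtain v where v: "h \<in> rist G v" "v \<in> level n" by blast
    have "m_inv Aut h = inv_into UNIV h" using ristD(1)[OF v(1)] G_Aut by (intro m_inv_Aut)
    thus ?case using rist[OF rist_inv[OF v(1)] v(2)] by simp }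
next
  case (eng h1 h2)
  then obtain r1 r2 where r: "r1 \<in> rist G u" "\<forall>y. h1 (u @ y) = r1 (u @ y)"
    "r2 \<in> rist G u" "\<forall>y. h2 (u @ y) = r2 (u @ y)" by blast
  have "r1 (u @ y) = u @ section_at r1 u y" for y
    using section_at_append[of r1 u y] ristD[OF r(1)] G_Aut by simp
  hence "\<forall>y. (h2 \<circ> h1) (u @ y) = (r2 \<circ> r1) (u @ y)" using r by simp
  moreover have "h2 \<circ> h1 \<in> G" using eng G_comp by blast
  moreover from this have "h2 \<circ> h1 \<in> St n" using eng G_Aut by (auto simp: St_def)
  ultimately show ?case unfolding Aut_sel using rist_comp[OF r(1,3)] by blast
qed

text \<open>
  The sections at \<open>u\<close> of the rigid stabilizer form a subgroup of finite index in \<open>G\<close>: all of \<open>G\<close>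
  occurs as sections of the stabilizer of level \<open>n\<close>, in which \<open>Rist G n\<close> has finite index. So among
  the elements of a coset of it modulo level \<open>m\<close>, the proportion fixing a vertex of level \<open>m\<close>
  exceeds the proportion in \<open>G\<close> by at most the factor \<open>C\<close>, which does not depend on \<open>m\<close> or on the coset.
  The set \<open>R\<close> consists of lifts to the rigid stabilizer of this subgroup modulo level \<open>m\<close>.
\<close>

lemma few_coset_elements_with_fixed_point:
  assumes "u \<in> level n" "n \<ge> 1"
  obtains C :: nat where "\<And>m. \<exists>R. finite R \<and> R \<noteq> {} \<and> R \<subseteq> rist G u \<and>
    (\<forall>h\<in>G. h u = u \<longrightarrow>
      card {r\<in>R. \<exists>y\<in>level m. h (r (u @ y)) = u @ y} \<le> C * card R * prob (fixing m))"
proof -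
  let ?c = "\<lambda>a. Rist G n #>\<^bsub>Aut\<^esub> a"
  obtain T where T: "T \<subseteq> St n \<inter> G" "inj_on ?c T" "?c ` (St n \<inter> G) = ?c ` T"
    using subset_image_inj[of "?c ` (St n \<inter> G)" ?c "St n \<inter> G"] by auto
  have "?c ` (St n \<inter> G) \<subseteq> rcosets\<^bsub>Aut\<lparr>carrier := G\<rparr>\<^esub> (Rist G n)"
    by (auto simp: RCOSETS_def r_coset_def)
  moreover have "finite (rcosets\<^bsub>Aut\<lparr>carrier := G\<rparr>\<^esub> (Rist G n))"
    using branch_G assms(2) by (simp add: branch_def)
  ultimately have finT: "finite T"
    using T finite_subset finite_image_iff by metis
  have T_cover: "\<exists>t\<in>T. \<exists>\<rho>\<in>Rist G n. s = t \<circ> \<rho>" if "s \<in> St n \<inter> G" for s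
  proof -
    have "id \<in> Rist G n" using generate.one[of Aut] by (simp add: Rist_def)
    hence "s \<in> ?c s" unfolding r_coset_def by (rule UN_I) simp
    moreover have "?c s \<in> ?c ` T" using that T(3) by (metis imageI)
    ultimately obtain t where "t \<in> T" "s \<in> ?c t" by (metis imageE)
    thus ?thesis by (auto simp: r_coset_def)
  qed
  have sec: "s (u @ y) = u @ section_at s u y" if "s \<in> G" "s u = u" for s y
    using section_at_append[OF G_Aut[OF that(1)], of u y] that(2) by simp
  have levelA: "s y \<in> level m \<longleftrightarrow> y \<in> level m" if "s \<in> G" for s y m
    using Aut_length[OF G_Aut[OF that]] by (simp add: level_def)
  show thesis
  proof (rule that[of "card T"])
    fix m
    obtain R where R: "finite R" "R \<subseteq> rist G u"
      "\<And>s. s \<in> rist G u \<Longrightarrow> \<exists>r\<in>R. \<forall>y\<in>level (n + m). s y = r y"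
      "\<And>r r'. r \<in> R \<Longrightarrow> r' \<in> R \<Longrightarrow> \<forall>y\<in>level (n + m). r y = r' y \<Longrightarrow> r = r'"
      by (rule finite_level_representatives[of "rist G u" "n + m"])
        (use ristD(1) G_Aut in \<open>auto intro: that\<close>)
    have RG: "r \<in> G" "r u = u" if "r \<in> R" for r using ristD R(2) that by auto
    have R_inj: "r = r'" if "r \<in> R" "r' \<in> R" "\<forall>y\<in>level m. r (u @ y) = r' (u @ y)" for r r'
    proof (rule R(4)[OF that(1,2)], rule ballI)
      fix w :: "'a list" assume w: "w \<in> level (n + m)"
      show "r w = r' w"
      proof (cases "prefix u w")
        case True
        then obtain y where "w = u @ y" by (auto simp: prefix_def)
        thus ?thesis using that(3) w assms(1) by (auto simp: level_def)
      next
        case False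
        moreover have "r \<in> rist G u" "r' \<in> rist G u" using that(1,2) R(2) by auto
        ultimately show ?thesis by (simp add: rist_def)
      qed
    qed
    define S where "S = {g\<in>G. \<forall>y\<in>level m. g y = y}"
    have S: "level_determined m S" by (rule level_determinedI) (auto simp: S_def level_def)
    have Sev: "S \<in> sets \<mu>" by (rule level_determined_events[OF S])
    \<comment> \<open>Modulo \<open>S\<close>, the inverse of every element of \<open>G\<close> is the section of some \<open>r \<in> R\<close> followed by that of some \<open>t \<in> T\<close>.\<close>
    have lower: "1 \<le> card T * card R * prob S"
    proof -
      have "prob G \<le> card (R \<times> T) * prob S"
      proof (rule prob_le_card_mult_of_translates[where t = "\<lambda>(r, t). section_at t u \<circ> section_at r u"])
        show "finite (R \<times> T)" using R(1) finT by simp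
        show "(\<lambda>(r, t). section_at t u \<circ> section_at r u) ` (R \<times> T) \<subseteq> G"
          using T(1) RG section_in_G G_comp by auto
        fix g assume g: "g \<in> G"
        obtain s where s: "s \<in> St n" "s \<in> G" "section_at s u = inv_into UNIV g"
          using stabilizer_with_section[OF assms(1) G_inv[OF g]] .
        obtain t \<rho> where t: "t \<in> T" "\<rho> \<in> Rist G n" "s = t \<circ> \<rho>" using T_cover s by blast
        obtain r0 where r0: "r0 \<in> rist G u" "\<forall>y. \<rho> (u @ y) = r0 (u @ y)"
          using Rist_acts_as_rist[OF t(2) assms(1)] by blast
        obtain r where r: "r \<in> R" "\<forall>y\<in>level (n + m). r0 y = r y" using R(3)[OF r0(1)] by blast
        have tu: "t u = u" "t \<in> G" using t T assms(1) by (auto simp: St_def)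
        have su: "s u = u" using s(1) assms(1) by (auto simp: St_def)
        have "section_at t u (section_at r u y) = inv_into UNIV g y" if y: "y \<in> level m" for y
        proof -
          have "r0 (u @ y) = r (u @ y)" using r(2) y assms(1) by (auto simp: level_def)
          moreover have "u @ section_at s u y = t (\<rho> (u @ y))"
            using sec[OF s(2) su, of y] fun_cong[OF t(3), of "u @ y"] by simp
          ultimately have "u @ section_at s u y = t (r (u @ y))" using r0(2) by simp
          also have "\<dots> = u @ section_at t u (section_at r u y)"
            using sec[OF RG(1,2)[OF r(1)]] sec[OF tu(2,1)] by simp
          finally show ?thesis using s(3) by simp
        qed
        hence "g \<circ> (section_at t u \<circ> section_at r u) \<in> S"
          using g tu(2) RG(1)[OF r(1)] section_in_G G_comp Aut_inv_inv(2)[OF G_Aut[OF g]]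
          by (simp add: S_def)
        thus "\<exists>p\<in>R \<times> T. g \<circ> (case p of (r, t) \<Rightarrow> section_at t u \<circ> section_at r u) \<in> S"
          using r(1) t(1) by (intro bexI[of _ "(r, t)"]) auto
      qed (use Sev in auto)
      thus ?thesis using prob_space by (simp add: space_Haar card_cartesian_product mult.commute)
    qed
    \<comment> \<open>The elements counted here give disjoint cosets of \<open>S\<close> inside \<open>fixing m\<close>.\<close>
    have upper: "card {r\<in>R. \<exists>y\<in>level m. h (r (u @ y)) = u @ y} * prob S \<le> prob (fixing m)"
      if h: "h \<in> G" "h u = u" for h
    proof -
      let ?B = "{r\<in>R. \<exists>y\<in>level m. h (r (u @ y)) = u @ y}"
      let ?s = "\<lambda>r. section_at h u \<circ> section_at r u"
      define W where "W = (\<lambda>r. {g\<in>G. \<forall>y\<in>level m. g y = ?s r y})"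
      have sG: "?s r \<in> G" if "r \<in> R" for r
        using section_in_G RG(1)[OF that] h(1) by (intro G_comp) auto
      have hr: "h (r (u @ y)) = u @ ?s r y" if "r \<in> R" for r y
        using sec[OF RG(1,2)[OF that]] sec[OF h] by simp
      have W: "level_determined m (W r)" for r
        by (rule level_determinedI) (auto simp: W_def level_def)
      have pW: "prob (W r) = prob S" if r: "r \<in> R" for r
      proof -
        have "g \<circ> ?s r \<in> W r \<longleftrightarrow> g \<in> S" if g: "g \<in> G" for g
        proof
          assume "g \<in> S"
          thus "g \<circ> ?s r \<in> W r"
            using levelA[OF sG[OF r]] G_comp[OF sG[OF r]] by (auto simp: S_def W_def)
        next
          assume gs: "g \<circ> ?s r \<in> W r"
          have "g y = y" if y: "y \<in> level m" for y
          proof -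
            let ?z = "inv_into UNIV (?s r) y"
            have z: "?s r ?z = y" using Aut_inv_inv(2)[OF G_Aut[OF sG[OF r]]] .
            hence "?z \<in> level m" using levelA[OF sG[OF r], of ?z m] y by simp
            hence "(g \<circ> ?s r) ?z = ?s r ?z" using gs unfolding W_def by blast
            thus ?thesis using z by simp
          qed
          thus "g \<in> S" using g by (simp add: S_def)
        qed
        hence eq: "{g\<in>G. g \<circ> ?s r \<in> W r} = S" by (auto simp: S_def)
        show ?thesis using prob_translate[OF sG[OF r] level_determined_events[OF W], of r] unfolding eq by (rule sym)
      qed
      have "disjoint_family_on W ?B"
        unfolding disjoint_family_on_def
      proof (intro ballI impI)
        fix r r' assume r: "r \<in> ?B" "r' \<in> ?B" "r \<noteq> r'"
        show "W r \<inter> W r' = {}"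
        proof (rule ccontr)
          assume "W r \<inter> W r' \<noteq> {}"
          then obtain g where "g \<in> W r" "g \<in> W r'" by blast
          hence "\<forall>y\<in>level m. ?s r y = ?s r' y" by (simp add: W_def)
          hence "\<forall>y\<in>level m. h (r (u @ y)) = h (r' (u @ y))" using hr r by simp
          hence "\<forall>y\<in>level m. r (u @ y) = r' (u @ y)"
            using Aut_bij[OF G_Aut[OF h(1)]] by (meson bij_is_inj injD)
          thus False using R_inj r by blast
        qed
      qed
      hence "(\<Sum>r\<in>?B. prob (W r)) = prob (\<Union>r\<in>?B. W r)"
        using R(1) level_determined_events[OF W] by (intro finite_measure_finite_Union[symmetric]) auto
      also have "\<dots> \<le> prob (fixing m)"
      proof (rule finite_measure_mono[OF _ level_determined_events[OF fixing_level_determined]])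
        show "(\<Union>r\<in>?B. W r) \<subseteq> fixing m"
        proof
          fix g assume "g \<in> (\<Union>r\<in>?B. W r)"
          then obtain r y where "r \<in> R" "y \<in> level m" "h (r (u @ y)) = u @ y" "g \<in> W r" by blast
          thus "g \<in> fixing m" using hr[of r y] by (auto simp: W_def fixing_def intro!: bexI[of _ y])
        qed
      qed
      finally show ?thesis using pW by simp
    qed
    have "R \<noteq> {}" using R(3)[OF rist_id] by blast
    moreover have "card {r\<in>R. \<exists>y\<in>level m. h (r (u @ y)) = u @ y} \<le> card T * card R * prob (fixing m)"
      if h: "h \<in> G" "h u = u" for h
    proof -
      let ?b = "real (card {r\<in>R. \<exists>y\<in>level m. h (r (u @ y)) = u @ y})"
      have "?b * 1 \<le> ?b * (card T * card R * prob S)" using lower by (intro mult_left_mono) auto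
      also have "\<dots> = card T * card R * (?b * prob S)" by simp
      also have "\<dots> \<le> card T * card R * prob (fixing m)"
        using upper[OF h] by (intro mult_left_mono) auto
      finally show ?thesis by simp
    qed
    ultimately show "\<exists>R. finite R \<and> R \<noteq> {} \<and> R \<subseteq> rist G u \<and>
      (\<forall>h\<in>G. h u = u \<longrightarrow>
        card {r\<in>R. \<exists>y\<in>level m. h (r (u @ y)) = u @ y} \<le> card T * card R * prob (fixing m))"
      using R(1,2) by blast
  qed
qed

end

section \<open>Words and their loops\<close>

definition letter_act :: "('i \<Rightarrow> 'x list \<Rightarrow> 'x list) \<Rightarrow> 'i \<times> bool \<Rightarrow> 'x list \<Rightarrow> 'x list" where
  "letter_act g a = (if snd a then g (fst a) else inv_into UNIV (g (fst a)))"

text \<open>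
  The first letter acts first, so that \<open>word_act g\<close> turns concatenation into the product of
  automorphisms acting on the right.
\<close>

primrec word_act :: "('i \<Rightarrow> 'x list \<Rightarrow> 'x list) \<Rightarrow> ('i \<times> bool) list \<Rightarrow> 'x list \<Rightarrow> 'x list" where
  "word_act g [] = id"
| "word_act g (a # w) = word_act g w \<circ> letter_act g a"

lemma word_act_Cons: "word_act g (a # w) z = word_act g w (letter_act g a z)"
  by simp

lemma word_act_append: "word_act g (v @ w) = word_act g w \<circ> word_act g v"
  by (induction v) (simp_all add: o_assoc)

lemma letter_act_subgroup:
  assumes "subgroup H Aut" "g (fst a) \<in> H"
  shows "letter_act g a \<in> H"
proof -
  have "g (fst a) \<in> carrier Aut" using assms subgroup.subset by blast
  thus ?thesis
    using assms subgroup.m_inv_closed[OF assms] by (simp add: letter_act_def m_inv_Aut)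
qed

lemma word_act_subgroup:
  assumes "subgroup H Aut" "\<And>a. a \<in> set w \<Longrightarrow> g (fst a) \<in> H"
  shows "word_act g w \<in> H"
  using assms(2)
proof (induction w)
  case Nil
  show ?case using subgroup.one_closed[OF assms(1)] by (simp only: word_act.simps Aut_sel)
next
  case (Cons a w)
  have "letter_act g a \<otimes>\<^bsub>Aut\<^esub> word_act g w \<in> H"
    using Cons by (intro subgroup.m_closed[OF assms(1)] letter_act_subgroup[OF assms(1)]) auto
  thus ?case by (simp only: word_act.simps Aut_sel)
qed

lemma subgroup_Aut_carrier: "subgroup (carrier Aut) Aut"
  using group.subgroup_self[OF group_Aut] .

lemma Aut_prefix:
  assumes "g \<in> carrier Aut" "prefix x z"
  shows "prefix (g x) (g z)"
  using assms section_at_append[OF assms(1)] by (auto simp: prefix_def)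

text \<open>
  A letter \<open>(i, True)\<close> applied at a vertex \<open>p\<close> uses the section of \<open>g i\<close> at \<open>p\<close>, while \<open>(i, False)\<close> uses
  the section at the vertex it arrives at. If none of these is \<open>u\<close>, the word never notices that
  \<open>g i\<close> is precomposed with an element moving only vertices below \<open>u\<close>.
\<close>

lemma word_act_perturb:
  assumes "\<And>b. b \<in> set w \<Longrightarrow> g (fst b) \<in> carrier Aut"
    and r: "r \<in> carrier Aut" "\<And>z. \<not> prefix u z \<Longrightarrow> r z = z"
    and "\<And>j. j < length w \<Longrightarrow> w ! j = (i, True) \<Longrightarrow> word_act g (take j w) x \<noteq> u"
    and "\<And>j. j < length w \<Longrightarrow> w ! j = (i, False) \<Longrightarrow> word_act g (take (Suc j) w) x \<noteq> u"
    and "length x = length u" "prefix x z"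
  shows "word_act (g(i := g i \<circ> r)) w z = word_act g w z"
  using assms(1,4,5,6,7)
proof (induction w arbitrary: x z)
  case (Cons a w)
  let ?g' = "g(i := g i \<circ> r)" and ?x' = "letter_act g a x"
  have a: "letter_act g a \<in> carrier Aut"
    using Cons.prems(1) by (intro letter_act_subgroup[OF subgroup_Aut_carrier]) auto
  have r_fix: "r y = y" if "prefix p y" "p \<noteq> u" "length p = length u" for p y
    using that by (intro r(2)) (auto simp: prefix_def)
  have first: "letter_act ?g' a z = letter_act g a z"
  proof (cases "fst a = i")
    case i: True
    show ?thesis
    proof (cases "snd a")
      case True
      hence "x \<noteq> u" using Cons.prems(2)[of 0] i by (cases a) auto
      hence "r z = z" using r_fix Cons.prems(4,5) by blast
      thus ?thesis using True i by (simp add: letter_act_def)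
    next
      case False
      let ?y = "letter_act g a z"
      have gi: "g i \<in> carrier Aut" using Cons.prems(1)[of a] i by simp
      have "?x' \<noteq> u" using Cons.prems(3)[of 0] i False by (cases a) auto
      moreover have "prefix ?x' ?y" by (rule Aut_prefix[OF a Cons.prems(5)])
      moreover have "length ?x' = length u" using Aut_length[OF a] Cons.prems(4) by simp
      ultimately have "r ?y = ?y" using r_fix by blast
      hence "(g i \<circ> r) ?y = z" using False i Aut_inv_inv(2)[OF gi] by (simp add: letter_act_def)
      moreover have "inj (g i \<circ> r)"
        using Aut_bij[OF gi] Aut_bij[OF r(1)] by (simp add: bij_is_inj inj_compose)
      ultimately have "inv_into UNIV (g i \<circ> r) z = ?y" by (simp add: inv_f_eq)
      thus ?thesis using False i by (simp add: letter_act_def)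
    qed
  qed (simp add: letter_act_def)
  have "word_act ?g' w (letter_act g a z) = word_act g w (letter_act g a z)"
  proof (rule Cons.IH[of ?x'])
    show "g (fst b) \<in> carrier Aut" if "b \<in> set w" for b using Cons.prems(1) that by simp
    show "word_act g (take j w) ?x' \<noteq> u" if "j < length w" "w ! j = (i, True)" for j
      using Cons.prems(2)[of "Suc j"] that by simp
    show "word_act g (take (Suc j) w) ?x' \<noteq> u" if "j < length w" "w ! j = (i, False)" for j
      using Cons.prems(3)[of "Suc j"] that by simp
    show "length ?x' = length u" using Aut_length[OF a] Cons.prems(4) by simp
    show "prefix ?x' (letter_act g a z)" by (rule Aut_prefix[OF a Cons.prems(5)])
  qed
  thus ?case unfolding word_act_Cons first .
qed simp

definition simple_loop :: "('i \<Rightarrow> 'x list \<Rightarrow> 'x list) \<Rightarrow> ('i \<times> bool) list \<Rightarrow> 'x list \<Rightarrow> bool" where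
  "simple_loop g w v \<longleftrightarrow> word_act g w v = v \<and>
     (\<forall>j<length w. \<forall>l<j. word_act g (take l w) v \<noteq> word_act g (take j w) v)"

text \<open>
  The vertex at which the letter \<open>a\<close>, applied at \<open>v\<close>, uses the section of its generator: for an
  inverse letter this is the vertex it arrives at.
\<close>

definition pivot :: "('i \<Rightarrow> 'x list \<Rightarrow> 'x list) \<Rightarrow> 'i \<times> bool \<Rightarrow> 'x list \<Rightarrow> 'x list" where
  "pivot g a v = (if snd a then v else letter_act g a v)"

lemma reduced_second: "reduced (a # w) \<Longrightarrow> w \<noteq> [] \<Longrightarrow> w ! 0 \<noteq> letter_inv a"
  by (cases w) (auto simp: reduced_def)

lemma simple_loop_distinct:
  assumes "simple_loop g w v" "l < length w" "j < length w" "word_act g (take l w) v = word_act g (take j w) v"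
  shows "l = j"
  using assms unfolding simple_loop_def by (metis linorder_neqE_nat)

text \<open>
  Along a simple loop two letters with the same generator and the same sign use sections at
  different vertices. Letters of opposite sign use the same section only if one directly follows
  the other in the cyclic order. For neighbours within the word this contradicts reducedness; for the last letter and
  the first, the second and the last vertex of the loop would coincide, which leaves only words of
  length 2, where the two letters are neighbours within the word as well.
\<close>

lemma pivot_not_revisited:
  assumes g: "\<And>b. b \<in> set (a # w) \<Longrightarrow> g (fst b) \<in> carrier Aut"
    and red: "reduced (a # w)" and loop: "simple_loop g (a # w) v" and j: "j < length w"
  shows "w ! j = (fst a, True) \<Longrightarrow> word_act g (take j w) (letter_act g a v) \<noteq> pivot g a v"
    and "w ! j = (fst a, False) \<Longrightarrow> word_act g (take (Suc j) w) (letter_act g a v) \<noteq> pivot g a v"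
proof -
  define X where "X = (\<lambda>j. word_act g (take j (a # w)) v)"
  have X0: "X 0 = v" and X1: "X 1 = letter_act g a v"
    and XS: "X (Suc l) = word_act g (take l w) (letter_act g a v)" for l
    by (simp_all add: X_def)
  have Xinj: "l = m" if "X l = X m" "l \<le> length w" "m \<le> length w" for l m
    using simple_loop_distinct[OF loop, of l m] that by (simp add: X_def less_Suc_eq_le)
  have Xend: "X (Suc (length w)) = v" using loop by (simp add: X_def simple_loop_def)
  have Xstep: "X (Suc (Suc l)) = letter_act g (w ! l) (X (Suc l))" if "l < length w" for l
    using that by (simp add: XS take_Suc_conv_app_nth word_act_append)
  have second: "w ! 0 \<noteq> letter_inv a" using j by (intro reduced_second[OF red]) auto
  show "word_act g (take j w) (letter_act g a v) \<noteq> pivot g a v" if wj: "w ! j = (fst a, True)"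
  proof
    assume eq: "word_act g (take j w) (letter_act g a v) = pivot g a v"
    show False
    proof (cases "snd a")
      case True
      hence "X (Suc j) = X 0" using eq by (simp add: XS X0 pivot_def)
      thus False using Xinj[of "Suc j" 0] j by simp
    next
      case False
      hence "X (Suc j) = X 1" using eq by (simp add: XS X1 pivot_def)
      hence "j = 0" using Xinj[of "Suc j" 1] j by simp
      thus False using second wj False by (simp add: letter_inv_def)
    qed
  qed
  show "word_act g (take (Suc j) w) (letter_act g a v) \<noteq> pivot g a v" if wj: "w ! j = (fst a, False)"
  proof
    assume eq: "word_act g (take (Suc j) w) (letter_act g a v) = pivot g a v"
    show False
    proof (cases "snd a")
      case True
      hence eq0: "X (Suc (Suc j)) = X 0" using eq by (simp add: XS X0 pivot_def)
      have ga: "g (fst a) \<in> carrier Aut" using g by simp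
      have "inv_into UNIV (g (fst a)) (X (Suc j)) = v"
        using Xstep[OF j] eq0 wj by (simp add: letter_act_def X0)
      hence "X (Suc j) = g (fst a) v" using Aut_inv_inv(2)[OF ga, of "X (Suc j)"] by simp
      hence "X (Suc j) = X 1" using True X1 by (simp add: letter_act_def)
      hence "j = 0" using Xinj[of "Suc j" 1] j by simp
      thus False using second wj True by (simp add: letter_inv_def)
    next
      case False
      hence eq1: "X (Suc (Suc j)) = X 1" using eq by (simp add: XS X1 pivot_def)
      show False
      proof (cases "Suc j < length w")
        case True
        thus False using Xinj[of "Suc (Suc j)" 1] eq1 by simp
      next
        case False
        hence "Suc j = length w" using j by simp
        hence "X 0 = X 1" using eq1 Xend X0 by simp
        thus False using Xinj[of 0 1] j by simp
      qed
    qed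
  qed
qed

text \<open>
  Only the first letter sees the perturbation, and it sends \<open>v\<close> to the same vertex as before because
  \<open>r\<close> fixes the pivot. So the loop survives, and below \<open>v\<close> the word changes in its first factor alone.
\<close>

lemma simple_loop_perturb:
  assumes g: "\<And>b. b \<in> set (a # w) \<Longrightarrow> g (fst b) \<in> carrier Aut"
    and red: "reduced (a # w)" and loop: "simple_loop g (a # w) v"
    and r: "r \<in> carrier Aut" "\<And>z. \<not> prefix (pivot g a v) z \<Longrightarrow> r z = z" "r (pivot g a v) = pivot g a v"
  defines "g' \<equiv> g(fst a := g (fst a) \<circ> r)"
  shows "simple_loop g' (a # w) v" "pivot g' a v = pivot g a v"
    and "prefix v z \<Longrightarrow> word_act g' (a # w) z = word_act g w (letter_act g' a z)"
    and "snd a \<Longrightarrow> letter_act g' a z = letter_act g a (r z)"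
    and "\<not> snd a \<Longrightarrow> letter_act g' a z = inv_into UNIV r (letter_act g a z)"
proof -
  let ?i = "fst a" and ?u = "pivot g a v"
  have gi: "g ?i \<in> carrier Aut" using g by simp
  have bij: "bij (g ?i)" "bij r" using gi r(1) Aut_bij by auto
  show pos: "letter_act g' a z = letter_act g a (r z)" if "snd a" for z
    using that by (simp add: letter_act_def g'_def)
  show neg: "letter_act g' a z = inv_into UNIV r (letter_act g a z)" if "\<not> snd a" for z
    using that bij by (simp add: letter_act_def g'_def o_inv_distrib)
  have g': "g' (fst b) \<in> carrier Aut" if "b \<in> set (a # w)" for b
    using g[OF that] subgroup.m_closed[OF subgroup_Aut_carrier r(1) gi] by (simp add: g'_def)
  have a': "letter_act g' a \<in> carrier Aut"
    using g' by (intro letter_act_subgroup[OF subgroup_Aut_carrier]) auto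
  have same: "letter_act g' a v = letter_act g a v"
  proof (cases "snd a")
    case True
    thus ?thesis using pos r(3) by (simp add: pivot_def)
  next
    case False
    have "inv_into UNIV r ?u = ?u" using Aut_inv_inv(1)[OF r(1), of ?u] r(3) by simp
    thus ?thesis using neg False by (simp add: pivot_def)
  qed
  have len: "length (letter_act g a v) = length ?u"
    using Aut_length[OF a', of v] same by (simp add: pivot_def)
  have rest: "word_act g' (take l w) z = word_act g (take l w) z"
    if "prefix (letter_act g a v) z" for l z
    unfolding g'_def
  proof (rule word_act_perturb[OF _ r(1,2) _ _ len that])
    show "g (fst b) \<in> carrier Aut" if "b \<in> set (take l w)" for b
      using g[of b] in_set_takeD[OF that] by simp
    show "word_act g (take j (take l w)) (letter_act g a v) \<noteq> ?u"
      if "j < length (take l w)" "take l w ! j = (?i, True)" for j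
    proof -
      have jl: "j < length w" "j < l" using that(1) by simp_all
      hence "take j (take l w) = take j w" "w ! j = (?i, True)" using that(2) by (simp_all add: min_absorb1)
      thus ?thesis using pivot_not_revisited(1)[OF g red loop jl(1)] by simp
    qed
    show "word_act g (take (Suc j) (take l w)) (letter_act g a v) \<noteq> ?u"
      if "j < length (take l w)" "take l w ! j = (?i, False)" for j
    proof -
      have jl: "j < length w" "j < l" using that(1) by simp_all
      hence "take (Suc j) (take l w) = take (Suc j) w" "w ! j = (?i, False)"
        using that(2) by (simp_all add: min_absorb1)
      thus ?thesis using pivot_not_revisited(2)[OF g red loop jl(1)] by simp
    qed
  qed
  have traj: "word_act g' (take l (a # w)) v = word_act g (take l (a # w)) v" for l
    using rest[of "letter_act g a v"] same by (cases l) auto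
  show "simple_loop g' (a # w) v"
    using loop traj[of "length (a # w)"] traj unfolding simple_loop_def by simp
  show "pivot g' a v = pivot g a v" using same by (simp add: pivot_def)
  show "word_act g' (a # w) z = word_act g w (letter_act g' a z)" if "prefix v z"
    using rest[of "letter_act g' a z" "length w"] Aut_prefix[OF a' that] same by simp
qed

section \<open>Random tuples\<close>

context super_strongly_fractal_branch_group
begin

definition tuples :: "nat \<Rightarrow> (nat \<Rightarrow> 'a list \<Rightarrow> 'a list) measure" where
  "tuples k = PiM {..<k} (\<lambda>_. \<mu>)"

lemma prob_space_tuples: "prob_space (tuples k)"
  unfolding tuples_def by (intro prob_space_PiM) (rule prob_space_axioms)

lemma tuples_in_G: "g \<in> space (tuples k) \<Longrightarrow> i < k \<Longrightarrow> g i \<in> G"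
  by (auto simp: tuples_def space_PiM space_Haar)

lemma translate_tuple_measurable:
  assumes "i < k" "r \<in> G"
  shows "(\<lambda>g. g(i := g i \<circ> r)) \<in> measurable (tuples k) (tuples k)"
  unfolding tuples_def
proof (rule measurable_fun_upd[where J = "{..<k}"])
  have "(\<lambda>g. g i) \<in> measurable (PiM {..<k} (\<lambda>_. \<mu>)) \<mu>"
    using assms(1) measurable_component_singleton[of i "{..<k}" "\<lambda>_. \<mu>"] by simp
  from measurable_compose[OF this translate_measurable[OF assms(2)]]
  show "(\<lambda>g. g i \<circ> r) \<in> measurable (PiM {..<k} (\<lambda>_. \<mu>)) \<mu>" .
qed (use assms in auto)

text \<open>
  Left invariance of the product measure in one coordinate, checked on boxes.
\<close>

lemma distr_translate_tuple:
  assumes "i < k" "r \<in> G"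
  shows "distr (tuples k) (tuples k) (\<lambda>g. g(i := g i \<circ> r)) = tuples k"
proof -
  interpret P: product_sigma_finite "\<lambda>_. \<mu>" by standard
  let ?T = "\<lambda>g. g(i := g i \<circ> r)"
  have "PiM {..<k} (\<lambda>_. \<mu>) = distr (tuples k) (tuples k) ?T"
  proof (rule P.PiM_eqI[symmetric])
    fix A :: "nat \<Rightarrow> ('a list \<Rightarrow> 'a list) set"
    assume A: "\<And>l. l \<in> {..<k} \<Longrightarrow> A l \<in> sets \<mu>"
    let ?A = "A(i := {g\<in>G. g \<circ> r \<in> A i})"
    have A': "?A l \<in> sets \<mu>" if "l < k" for l
      using A that translate_events[OF assms(2) A, of i] assms(1) by auto
    have AG: "A l \<subseteq> G" if "l < k" for l
      using sets.sets_into_space[OF A] that by (simp add: space_Haar)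
    have "?T -` Pi\<^sub>E {..<k} A \<inter> space (tuples k) = Pi\<^sub>E {..<k} ?A"
    proof (intro equalityI subsetI)
      fix g assume "g \<in> ?T -` Pi\<^sub>E {..<k} A \<inter> space (tuples k)"
      hence g: "?T g \<in> Pi\<^sub>E {..<k} A" "g \<in> space (tuples k)" by auto
      have "g l \<in> ?A l" if "l < k" for l
        using PiE_mem[OF g(1), of l] tuples_in_G[OF g(2) that] that by (auto split: if_splits)
      moreover have "g \<in> extensional {..<k}" using g(2) by (auto simp: tuples_def space_PiM PiE_def)
      ultimately show "g \<in> Pi\<^sub>E {..<k} ?A" by (auto simp: PiE_iff)
    next
      fix g assume g: "g \<in> Pi\<^sub>E {..<k} ?A"
      have gl: "g l \<in> ?A l" if "l < k" for l using PiE_mem[OF g, of l] that by simp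
      have "g l \<in> G" if "l < k" for l
        using gl[OF that] AG[OF that] by (auto split: if_splits)
      moreover have ext: "g \<in> extensional {..<k}" using g by (auto simp: PiE_def)
      ultimately have "g \<in> space (tuples k)" by (auto simp: tuples_def space_PiM space_Haar PiE_iff)
      moreover have "?T g l \<in> A l" if "l < k" for l
        using gl[OF that] by (auto split: if_splits)
      moreover have "?T g \<in> extensional {..<k}" using ext assms(1) by (auto simp: extensional_def)
      ultimately show "g \<in> ?T -` Pi\<^sub>E {..<k} A \<inter> space (tuples k)" by (auto simp: PiE_iff)
    qed
    moreover have "Pi\<^sub>E {..<k} A \<in> sets (tuples k)"
      unfolding tuples_def using A by (intro sets_PiM_I_finite) auto
    ultimately have "emeasure (distr (tuples k) (tuples k) ?T) (Pi\<^sub>E {..<k} A)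
        = emeasure (tuples k) (Pi\<^sub>E {..<k} ?A)"
      using emeasure_distr[OF translate_tuple_measurable[OF assms]] by simp
    also have "\<dots> = (\<Prod>l<k. emeasure \<mu> (?A l))"
      unfolding tuples_def using A' by (intro P.emeasure_PiM) auto
    also have "\<dots> = (\<Prod>l<k. emeasure \<mu> (A l))"
      using emeasure_translate[OF assms(2) A] assms(1) by (intro prod.cong) auto
    finally show "emeasure (distr (tuples k) (tuples k) ?T) (Pi\<^sub>E {..<k} A)
        = (\<Prod>l\<in>{..<k}. emeasure \<mu> (A l))" .
  qed (simp_all add: tuples_def)
  thus ?thesis by (simp add: tuples_def)
qed

lemma measure_translate_tuple:
  assumes "i < k" "r \<in> G" "E \<in> sets (tuples k)"
  shows "{g\<in>space (tuples k). g(i := g i \<circ> r) \<in> E} \<in> sets (tuples k)"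
    and "measure (tuples k) {g\<in>space (tuples k). g(i := g i \<circ> r) \<in> E} = measure (tuples k) E"
proof -
  let ?T = "\<lambda>g. g(i := g i \<circ> r)"
  have eq: "{g\<in>space (tuples k). ?T g \<in> E} = ?T -` E \<inter> space (tuples k)" by auto
  show "{g\<in>space (tuples k). ?T g \<in> E} \<in> sets (tuples k)"
    unfolding eq by (rule measurable_sets[OF translate_tuple_measurable[OF assms(1,2)] assms(3)])
  have "measure (tuples k) E = measure (distr (tuples k) (tuples k) ?T) E"
    using distr_translate_tuple[OF assms(1,2)] by simp
  also have "\<dots> = measure (tuples k) (?T -` E \<inter> space (tuples k))"
    by (rule measure_distr[OF translate_tuple_measurable[OF assms(1,2)] assms(3)])
  finally show "measure (tuples k) {g\<in>space (tuples k). ?T g \<in> E} = measure (tuples k) E"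
    unfolding eq by simp
qed

lemma vertex_image_measurable: "(\<lambda>g. g v) \<in> measurable \<mu> (count_space UNIV)"
proof -
  have "{g\<in>G. g v = u} \<in> sets \<mu>" for u
    by (rule level_determined_events[of "length v"], rule level_determinedI) auto
  moreover have "(\<lambda>g. g v) -` {u} \<inter> space \<mu> = {g\<in>G. g v = u}" for u by (auto simp: space_Haar)
  ultimately show ?thesis by (subst measurable_count_space_eq2_countable) simp
qed

lemma letter_act_measurable:
  assumes "fst a < k"
  shows "(\<lambda>g. letter_act g a v) \<in> measurable (tuples k) (count_space UNIV)"
proof -
  have comp: "(\<lambda>g. g (fst a) u) \<in> measurable (tuples k) (count_space UNIV)" for u
  proof -
    have "(\<lambda>g. g (fst a)) \<in> measurable (tuples k) \<mu>"
      using assms measurable_component_singleton[of "fst a" "{..<k}" "\<lambda>_. \<mu>"] by (simp add: tuples_def)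
    from measurable_compose[OF this vertex_image_measurable] show ?thesis .
  qed
  show ?thesis
  proof (cases "snd a")
    case True
    thus ?thesis using comp by (simp add: letter_act_def)
  next
    case False
    have "(\<lambda>g. letter_act g a v) -` {u} \<inter> space (tuples k) = (\<lambda>g. g (fst a) u) -` {v} \<inter> space (tuples k)" for u
      using tuples_in_G[OF _ assms] G_Aut False by (auto simp: letter_act_def Aut_inv_inv)
    moreover have "(\<lambda>g. g (fst a) u) -` {v} \<inter> space (tuples k) \<in> sets (tuples k)" for u
      by (rule measurable_sets[OF comp]) simp
    ultimately show ?thesis by (subst measurable_count_space_eq2_countable) simp
  qed
qed

lemma word_act_measurable:
  assumes "\<And>a. a \<in> set w \<Longrightarrow> fst a < k"
  shows "(\<lambda>g. word_act g w v) \<in> measurable (tuples k) (count_space UNIV)"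
  using assms
proof (induction w arbitrary: v)
  case (Cons a w)
  have "(\<lambda>g. word_act g w (letter_act g a v)) \<in> measurable (tuples k) (count_space UNIV)"
  proof (rule measurable_compose_countable[where f = "\<lambda>u g. word_act g w u"])
    show "(\<lambda>g. word_act g w u) \<in> measurable (tuples k) (count_space UNIV)" for u
      using Cons by simp
    show "(\<lambda>g. letter_act g a v) \<in> measurable (tuples k) (count_space UNIV)"
      using Cons.prems by (intro letter_act_measurable) simp
  qed
  thus ?case by simp
qed simp

lemma word_act_eq_event:
  assumes "\<And>a. a \<in> set w \<Longrightarrow> fst a < k" "\<And>a. a \<in> set w' \<Longrightarrow> fst a < k"
  shows "{g\<in>space (tuples k). word_act g w v = word_act g w' v'} \<in> sets (tuples k)"
proof -
  have "{g\<in>space (tuples k). word_act g w v = word_act g w' v'} =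
    (\<Union>u. ((\<lambda>g. word_act g w v) -` {u} \<inter> space (tuples k)) \<inter> ((\<lambda>g. word_act g w' v') -` {u} \<inter> space (tuples k)))"
    by auto
  also have "\<dots> \<in> sets (tuples k)"
  proof (rule sets.countable_UN, rule image_subsetI, rule sets.Int)
    fix u :: "'a list"
    show "(\<lambda>g. word_act g w v) -` {u} \<inter> space (tuples k) \<in> sets (tuples k)"
      by (rule measurable_sets[OF word_act_measurable[OF assms(1)]]) simp_all
    show "(\<lambda>g. word_act g w' v') -` {u} \<inter> space (tuples k) \<in> sets (tuples k)"
      by (rule measurable_sets[OF word_act_measurable[OF assms(2)]]) simp_all
  qed
  finally show ?thesis .
qed

lemma simple_loop_event:
  assumes "\<And>a. a \<in> set w \<Longrightarrow> fst a < k"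
  shows "{g\<in>space (tuples k). simple_loop g w v} \<in> sets (tuples k)"
proof -
  have closed: "{g\<in>space (tuples k). word_act g w v = v} \<in> sets (tuples k)"
    using word_act_eq_event[of w k "[]" v v] assms by simp
  have neq: "{g\<in>space (tuples k). word_act g (take l w) v \<noteq> word_act g (take j w) v} \<in> sets (tuples k)" for l j
    using assms by (intro sets.sets_Collect_neg word_act_eq_event) (auto dest: in_set_takeD)
  have "{g\<in>space (tuples k). \<forall>j\<in>{..<length w}. \<forall>l\<in>{..<j}. word_act g (take l w) v \<noteq> word_act g (take j w) v}
      \<in> sets (tuples k)"
    by (rule sets.sets_Collect_finite_All[OF sets.sets_Collect_finite_All[OF neq]]) simp_all
  from sets.sets_Collect_conj[OF this closed] show ?thesis
    unfolding simple_loop_def Ball_def lessThan_iff .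
qed

definition loop_fixing_below ::
  "(nat \<times> bool) list \<Rightarrow> nat \<times> bool \<Rightarrow> 'a list \<Rightarrow> 'a list \<Rightarrow> nat \<Rightarrow> nat \<Rightarrow> (nat \<Rightarrow> 'a list \<Rightarrow> 'a list) set" where
  "loop_fixing_below w a v u k m = {g\<in>space (tuples k). simple_loop g (a # w) v \<and> pivot g a v = u \<and>
     (\<exists>y\<in>level m. word_act g (a # w) (v @ y) = v @ y)}"

lemma loop_fixing_below_event:
  assumes "\<And>b. b \<in> set (a # w) \<Longrightarrow> fst b < k"
  shows "loop_fixing_below w a v u k m \<in> sets (tuples k)"
proof -
  have "{g\<in>space (tuples k). letter_act g a v = u} = (\<lambda>g. letter_act g a v) -` {u} \<inter> space (tuples k)" by auto
  also have "\<dots> \<in> sets (tuples k)"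
    using assms by (intro measurable_sets[OF letter_act_measurable]) auto
  finally have "{g\<in>space (tuples k). pivot g a v = u} \<in> sets (tuples k)"
    by (cases "snd a") (auto simp: pivot_def)
  moreover have "{g\<in>space (tuples k). \<exists>y\<in>level m. word_act g (a # w) (v @ y) = v @ y} \<in> sets (tuples k)"
  proof (intro sets.sets_Collect_finite_Ex finite_level)
    fix y :: "'a list"
    show "{g\<in>space (tuples k). word_act g (a # w) (v @ y) = v @ y} \<in> sets (tuples k)"
      using word_act_eq_event[of "a # w" k "[]" "v @ y" "v @ y"] assms by simp
  qed
  ultimately show ?thesis
    unfolding loop_fixing_below_def using assms
    by (intro sets.sets_Collect_conj simple_loop_event) auto
qed

text \<open>
  Average the event over the perturbations of the first generator by the elements \<open>r\<close> of the finite
  set \<open>R\<close>; each of them preserves the measure. For a fixed tuple, the perturbed word fixes a vertex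
  \<open>m\<close> levels below \<open>v\<close> only if \<open>h \<circ> r\<close> fixes one \<open>m\<close> levels below \<open>u\<close>, for an element \<open>h\<close> of \<open>G\<close> that fixes \<open>u\<close> and is
  independent of \<open>r\<close>, so few \<open>r\<close> qualify.
\<close>

lemma measure_loop_fixing_below_le:
  assumes w: "\<And>b. b \<in> set (a # w) \<Longrightarrow> fst b < k" and red: "reduced (a # w)"
    and v: "v \<noteq> []" "length u = length v"
  obtains C :: nat where
    "\<And>m. measure (tuples k) (loop_fixing_below w a v u k m) \<le> C * prob (fixing m)"
proof -
  interpret P: prob_space "tuples k" by (rule prob_space_tuples)
  define n where "n = length v"
  have n: "n \<ge> 1" "u \<in> level n" using v by (auto simp: n_def level_def Suc_le_eq)
  obtain C :: nat where C: "\<And>m. \<exists>R. finite R \<and> R \<noteq> {} \<and> R \<subseteq> rist G u \<and>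
    (\<forall>h\<in>G. h u = u \<longrightarrow>
      card {r\<in>R. \<exists>y\<in>level m. h (r (u @ y)) = u @ y} \<le> C * card R * prob (fixing m))"
    by (rule few_coset_elements_with_fixed_point[OF n(2,1)]) (rule that)
  show thesis
  proof (rule that)
    fix m
    obtain R where R: "finite R" "R \<noteq> {}" "R \<subseteq> rist G u" and
      count: "\<And>h. h \<in> G \<Longrightarrow> h u = u \<Longrightarrow>
        card {r\<in>R. \<exists>y\<in>level m. h (r (u @ y)) = u @ y} \<le> C * card R * prob (fixing m)"
      using C[of m] by (elim exE conjE) (rule that, assumption, assumption, assumption, blast)
    let ?i = "fst a" and ?E = "loop_fixing_below w a v u k m"
    let ?T = "\<lambda>r g. g(?i := g ?i \<circ> r)"
    have i: "?i < k" using w by simp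
    have E: "?E \<in> sets (tuples k)" by (rule loop_fixing_below_event[OF w])
    have perturb: "simple_loop (?T r g) (a # w) v \<and> pivot (?T r g) a v = u \<and>
        (\<forall>z. prefix v z \<longrightarrow> word_act (?T r g) (a # w) z = word_act g w (letter_act (?T r g) a z))
        \<and> (\<forall>z. letter_act (?T r g) a z = (if snd a then letter_act g a (r z) else inv_into UNIV r (letter_act g a z)))"
      if g: "\<forall>b\<in>set (a # w). g (fst b) \<in> G" and l: "simple_loop g (a # w) v" "pivot g a v = u"
        and r: "r \<in> rist G u" for g r
    proof -
      have gA: "\<And>b. b \<in> set (a # w) \<Longrightarrow> g (fst b) \<in> carrier Aut" using g G_Aut by blast
      have rA: "r \<in> carrier Aut" "\<And>z. \<not> prefix (pivot g a v) z \<Longrightarrow> r z = z" "r (pivot g a v) = pivot g a v"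
        using r ristD[OF r] G_Aut l(2) by (auto simp: rist_def)
      note sp = simple_loop_perturb[OF gA red l(1) rA]
      show ?thesis using sp(1,2) sp(3) sp(4) sp(5) l(2) by simp
    qed
    have few: "card {r\<in>R. ?T r g \<in> ?E} \<le> C * card R * prob (fixing m)" if g: "g \<in> space (tuples k)" for g
    proof (cases "simple_loop g (a # w) v \<and> pivot g a v = u")
      case l: True
      have gG: "\<forall>b\<in>set (a # w). g (fst b) \<in> G" using tuples_in_G[OF g] w by blast
      have wG: "word_act g (a # w) \<in> G" "word_act g w \<in> G"
        using gG by (auto intro!: word_act_subgroup[OF subgroup_G] simp del: word_act.simps)
      have giG: "g ?i \<in> G" using gG by simp
      have closed: "word_act g w (letter_act g a v) = v"
        using l by (simp add: simple_loop_def)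
      \<comment> \<open>For an inverse first letter, follow the fixed vertex to its image \<open>t\<close> below \<open>u\<close> under that letter; the fixed vertex equation becomes \<open>h (r t) = t\<close>.\<close>
      define h where "h = (if snd a then word_act g (a # w) else inv_into UNIV (word_act g w) \<circ> g ?i)"
      have hG: "h \<in> G" using wG giG G_inv G_comp by (simp add: h_def)
      have hu: "h u = u"
      proof (cases "snd a")
        case True
        thus ?thesis using l closed by (simp add: h_def pivot_def)
      next
        case False
        hence ua: "u = inv_into UNIV (g ?i) v" using l by (simp add: pivot_def letter_act_def)
        hence "g ?i u = v" using Aut_inv_inv(2)[OF G_Aut[OF giG]] by simp
        moreover have "word_act g w u = v" using closed ua False by (simp add: letter_act_def)
        ultimately show ?thesis using False Aut_inv_inv(1)[OF G_Aut[OF wG(2)], of u] by (simp add: h_def)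
      qed
      have "\<exists>y\<in>level m. h (r (u @ y)) = u @ y" if r: "r \<in> R" and E: "?T r g \<in> ?E" for r
      proof -
        have rr: "r \<in> rist G u" using r R(3) by blast
        note rA = G_Aut[OF ristD(1)[OF rr]]
        note p = perturb[OF gG conjunct1[OF l] conjunct2[OF l] rr]
        obtain y where y: "y \<in> level m" "word_act (?T r g) (a # w) (v @ y) = v @ y"
          using E unfolding loop_fixing_below_def by blast
        have perturbed: "word_act (?T r g) (a # w) (v @ y) = word_act g w (letter_act (?T r g) a (v @ y))"
          by (rule p[THEN conjunct2, THEN conjunct2, THEN conjunct1, rule_format]) simp
        have first: "letter_act (?T r g) a (v @ y) =
            (if snd a then letter_act g a (r (v @ y)) else inv_into UNIV r (letter_act g a (v @ y)))"
          by (rule p[THEN conjunct2, THEN conjunct2, THEN conjunct2, rule_format])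
        have wy: "word_act g w (if snd a then letter_act g a (r (v @ y))
            else inv_into UNIV r (letter_act g a (v @ y))) = v @ y"
          using y(2) unfolding perturbed first .
        show ?thesis
        proof (cases "snd a")
          case True
          hence "v = u" using l by (simp add: pivot_def)
          moreover have "h (r (v @ y)) = v @ y" using wy True by (simp add: h_def)
          ultimately show ?thesis using y(1) by blast
        next
          case False
          let ?t = "inv_into UNIV r (inv_into UNIV (g ?i) (v @ y))"
          have t: "word_act g w ?t = v @ y" using wy False by (simp add: letter_act_def)
          have rt: "g ?i (r ?t) = v @ y"
            by (simp add: Aut_inv_inv(2)[OF rA] Aut_inv_inv(2)[OF G_Aut[OF giG]])
          have ht: "h (r ?t) = ?t"
            using rt t Aut_inv_inv(1)[OF G_Aut[OF wG(2)], of ?t] False by (simp add: h_def)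
          have iA: "inv_into UNIV r \<in> carrier Aut" "inv_into UNIV (g ?i) \<in> carrier Aut"
            using Aut_inv_closed rA G_Aut[OF giG] by auto
          have "inv_into UNIV (g ?i) v = u" using l False by (simp add: pivot_def letter_act_def)
          moreover have "inv_into UNIV r u = u"
            using Aut_inv_inv(1)[OF rA, of u] ristD(2)[OF rr] by simp
          ultimately have "take (length v) ?t = u"
            by (simp add: Aut_take[OF iA(1)] Aut_take[OF iA(2)])
          hence tt: "?t = u @ drop (length v) ?t" by (metis append_take_drop_id)
          moreover have "drop (length v) ?t \<in> level m"
            using y(1) Aut_length[OF iA(1)] Aut_length[OF iA(2)] by (simp add: level_def)
          ultimately show ?thesis using ht by metis
        qed
      qed
      hence "card {r\<in>R. ?T r g \<in> ?E} \<le> card {r\<in>R. \<exists>y\<in>level m. h (r (u @ y)) = u @ y}"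
        using R(1) by (intro card_mono) auto
      thus ?thesis using count[OF hG hu] by linarith
    next
      case False
      \<comment> \<open>Undoing the perturbation would turn a loop of the perturbed tuple into one of the tuple itself.\<close>
      have "?T r g \<notin> ?E" if r: "r \<in> R" for r
      proof
        assume E: "?T r g \<in> ?E"
        have rr: "r \<in> rist G u" using r R(3) by blast
        have "\<forall>b\<in>set (a # w). ?T r g (fst b) \<in> G"
          using E w tuples_in_G unfolding loop_fixing_below_def by blast
        from perturb[OF this _ _ rist_inv[OF rr]] E
        have "simple_loop (?T (inv_into UNIV r) (?T r g)) (a # w) v \<and> pivot (?T (inv_into UNIV r) (?T r g)) a v = u"
          unfolding loop_fixing_below_def by blast
        moreover have "?T (inv_into UNIV r) (?T r g) = g"
          by (auto simp: fun_eq_iff Aut_inv_inv(2)[OF G_Aut[OF ristD(1)[OF rr]]])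
        ultimately show False using False by simp
      qed
      hence none: "{r\<in>R. ?T r g \<in> ?E} = {}" by blast
      show ?thesis unfolding none by simp
    qed
    let ?S = "\<lambda>r. {g\<in>space (tuples k). ?T r g \<in> ?E}"
    have rG: "r \<in> G" if "r \<in> R" for r using that R(3) ristD(1) by blast
    have S: "?S r \<in> sets (tuples k)" "measure (tuples k) (?S r) = measure (tuples k) ?E" if "r \<in> R" for r
      using measure_translate_tuple[OF i rG[OF that] E] by auto
    have "card R * measure (tuples k) ?E = (\<Sum>r\<in>R. measure (tuples k) (?S r))"
      using S(2) by simp
    also have "\<dots> = P.expectation (\<lambda>g. real (card {r\<in>R. g \<in> ?S r}))"
      by (rule P.sum_prob_eq_expectation_card(1)[OF R(1) S(1)])
    also have "\<dots> \<le> C * card R * prob (fixing m)"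
    proof (rule P.integral_le_const)
      show "integrable (tuples k) (\<lambda>g. real (card {r\<in>R. g \<in> ?S r}))"
        by (rule P.sum_prob_eq_expectation_card(2)[OF R(1) S(1)])
      show "AE g in tuples k. real (card {r\<in>R. g \<in> ?S r}) \<le> C * card R * prob (fixing m)"
      proof (rule AE_I2)
        fix g assume g: "g \<in> space (tuples k)"
        have "{r\<in>R. g \<in> ?S r} = {r\<in>R. ?T r g \<in> ?E}" using g by blast
        thus "real (card {r\<in>R. g \<in> ?S r}) \<le> C * card R * prob (fixing m)" using few[OF g] by simp
      qed
    qed
    finally have "card R * measure (tuples k) ?E \<le> card R * (C * prob (fixing m))" by (simp add: mult_ac)
    moreover have "card R > 0" using R(1,2) by (simp add: card_gt_0_iff)
    ultimately show "measure (tuples k) ?E \<le> C * prob (fixing m)" by simp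
  qed
qed

text \<open>
  By compactness of the boundary, fixing vertices at every depth below \<open>v\<close> amounts to fixing a boundary point
  below \<open>v\<close>; the form with vertices is visibly a countable intersection of measurable conditions.
\<close>

definition loop_fixing_end :: "(nat \<times> bool) list \<Rightarrow> 'a list \<Rightarrow> (nat \<Rightarrow> 'a list \<Rightarrow> 'a list) \<Rightarrow> bool" where
  "loop_fixing_end w v g \<longleftrightarrow> simple_loop g w v \<and> (\<forall>m. \<exists>y\<in>level m. word_act g w (v @ y) = v @ y)"

text \<open>
  The pivot depends on the tuple when the first letter is an inverse, so the event is first split
  according to its countably many possible values.
\<close>

lemma AE_no_loop_fixing_end:
  assumes "CARD('a) \<ge> 2"
    and w: "\<And>b. b \<in> set w \<Longrightarrow> fst b < k" and red: "reduced w" "w \<noteq> []" and v: "v \<noteq> []"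
  shows "AE g in tuples k. \<not> loop_fixing_end w v g"
proof -
  interpret P: prob_space "tuples k" by (rule prob_space_tuples)
  obtain a w' where ww: "w = a # w'" using red(2) by (cases w) auto
  have "AE g in tuples k. \<not> (loop_fixing_end w v g \<and> pivot g a v = u)" for u
  proof (cases "length u = length v")
    case True
    obtain C :: nat where C: "\<And>m. measure (tuples k) (loop_fixing_below w' a v u k m) \<le> C * prob (fixing m)"
      by (rule measure_loop_fixing_below_le[of a w' k v u])
         (use w red v True in \<open>auto simp: ww intro: that\<close>)
    have ev: "loop_fixing_below w' a v u k m \<in> sets (tuples k)" for m
      using w by (intro loop_fixing_below_event) (simp add: ww)
    let ?N = "\<Inter>m. loop_fixing_below w' a v u k m"
    have N: "?N \<in> sets (tuples k)" using ev by auto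
    have "measure (tuples k) ?N \<le> 0"
    proof (rule field_le_epsilon)
      fix e :: real assume e: "e > 0"
      obtain m where m: "prob (fixing m) < e / (C + 1)"
        using prob_fixing_arbitrarily_small[OF assms(1), of "e / (C + 1)"] e by auto
      have "measure (tuples k) ?N \<le> measure (tuples k) (loop_fixing_below w' a v u k m)"
        using ev by (intro P.finite_measure_mono) auto
      also have "\<dots> \<le> (C + 1) * prob (fixing m)" using add_increasing[OF measure_nonneg C[of m], of \<mu> "fixing m"] by (simp add: distrib_right)
      also have "\<dots> \<le> e" using m by (simp add: field_simps)
      finally show "measure (tuples k) ?N \<le> 0 + e" by simp
    qed
    hence "emeasure (tuples k) ?N = 0" by (simp add: P.emeasure_eq_measure measure_le_0_iff)
    moreover have "{g\<in>space (tuples k). \<not> \<not> (loop_fixing_end w v g \<and> pivot g a v = u)} \<subseteq> ?N"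
      by (auto simp: loop_fixing_end_def loop_fixing_below_def ww)
    ultimately show ?thesis using N by (intro AE_I) auto
  next
    case False
    show ?thesis
    proof (rule AE_I2)
      fix g assume g: "g \<in> space (tuples k)"
      have "letter_act g a \<in> carrier Aut"
        using tuples_in_G[OF g] G_Aut w by (intro letter_act_subgroup[OF subgroup_Aut_carrier]) (simp add: ww)
      hence "length (pivot g a v) = length v" by (simp add: pivot_def Aut_length)
      thus "\<not> (loop_fixing_end w v g \<and> pivot g a v = u)" using False by auto
    qed
  qed
  hence "AE g in tuples k. \<forall>u. \<not> (loop_fixing_end w v g \<and> pivot g a v = u)"
    by (subst AE_all_countable) simp
  thus ?thesis by eventually_elim simp
qed

end

text \<open>
  Induction on the length. If \<open>w\<close> fixes \<open>\<xi>\<close> and two proper initial segments send \<open>\<xi>\<close> to the same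
  boundary point, the subword between them is a shorter reduced word fixing that point. Otherwise
  the finitely many images of \<open>\<xi>\<close> are already separated at some finite level, and the prefix
  of \<open>\<xi>\<close> of that length starts a simple loop.
\<close>

lemma words_without_fixed_ends:
  assumes g: "\<And>i. i < k \<Longrightarrow> g i \<in> carrier Aut"
    and no_loop: "\<And>w v. fst ` set w \<subseteq> {..<k} \<Longrightarrow> reduced w \<Longrightarrow> w \<noteq> [] \<Longrightarrow> v \<noteq> [] \<Longrightarrow>
       \<not> (simple_loop g w v \<and> (\<forall>m. \<exists>y\<in>level m. word_act g w (v @ y) = v @ y))"
    and w: "fst ` set w \<subseteq> {..<k}" "reduced w" "w \<noteq> []"
  shows "boundary_act (word_act g w) \<xi> \<noteq> \<xi>"
  using w
proof (induction "length w" arbitrary: w \<xi> rule: less_induct)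
  case less
  define p where "p = (\<lambda>n. map \<xi> [0..<n])"
  have actA: "word_act g w' \<in> carrier Aut" if "fst ` set w' \<subseteq> {..<k}" for w'
    using that g by (intro word_act_subgroup[OF subgroup_Aut_carrier]) auto
  have takeA: "word_act g (take j w) \<in> carrier Aut" for j
    using less.prems(1) by (intro actA) (auto dest: in_set_takeD)
  show ?case
  proof
    assume fix_xi: "boundary_act (word_act g w) \<xi> = \<xi>"
    have fixed: "word_act g w (p n) = p n" for n
      using boundary_act_prefix[OF actA[OF less.prems(1)], of \<xi> n] fix_xi by (simp add: p_def)
    have ex: "\<exists>n. word_act g (take l w) (p n) \<noteq> word_act g (take j w) (p n)"
      if lj: "l < j" "j < length w" for l j
    proof (rule ccontr)
      assume "\<nexists>n. word_act g (take l w) (p n) \<noteq> word_act g (take j w) (p n)"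
      hence eq: "word_act g (take l w) (p n) = word_act g (take j w) (p n)" for n by blast
      define s where "s = drop l (take j w)"
      have tj: "take j w = take l w @ s"
        using lj append_take_drop_id[of l "take j w"] by (simp add: s_def min_def)
      have s: "length s < length w" "s \<noteq> []" "fst ` set s \<subseteq> {..<k}"
        using lj less.prems(1) by (auto simp: s_def dest!: in_set_dropD in_set_takeD)
      have "w = take l w @ s @ drop j w" using append_take_drop_id[of j w] tj by simp
      hence "reduced s" using less.prems(2) unfolding reduced_def
        by (metis successively_append_iff)
      define \<eta> where "\<eta> = boundary_act (word_act g (take l w)) \<xi>"
      have eta: "map \<eta> [0..<n] = word_act g (take l w) (p n)" for n
        unfolding \<eta>_def p_def by (rule boundary_act_prefix[OF takeA])
      have "word_act g s (map \<eta> [0..<n]) = map \<eta> [0..<n]" for n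
        unfolding eta using eq[of n] by (simp add: tj word_act_append)
      hence maps: "map (boundary_act (word_act g s) \<eta>) [0..<n] = map \<eta> [0..<n]" for n
        using boundary_act_prefix[OF actA[OF s(3)]] by simp
      have "boundary_act (word_act g s) \<eta> n = \<eta> n" for n
        using maps[of "Suc n"] by simp
      hence "boundary_act (word_act g s) \<eta> = \<eta>" by blast
      thus False using less.hyps[OF s(1,3) \<open>reduced s\<close> s(2)] by blast
    qed
    define f where "f = (\<lambda>l j. SOME n. word_act g (take l w) (p n) \<noteq> word_act g (take j w) (p n))"
    have f: "word_act g (take l w) (p (f l j)) \<noteq> word_act g (take j w) (p (f l j))"
      if "l < j" "j < length w" for l j
      unfolding f_def by (rule someI_ex[OF ex[OF that]])
    \<comment> \<open>A level beyond all separating levels; the successor keeps the prefix non-empty.\<close>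
    define N where "N = Suc (\<Sum>l<length w. \<Sum>j<length w. f l j)"
    have fN: "f l j \<le> N" if "l < length w" "j < length w" for l j
    proof -
      have "f l j \<le> (\<Sum>j<length w. f l j)" using that by (intro member_le_sum) auto
      also have "\<dots> \<le> (\<Sum>l<length w. \<Sum>j<length w. f l j)"
        using that by (intro member_le_sum[where f = "\<lambda>l. \<Sum>j<length w. f l j"]) auto
      finally show ?thesis by (simp add: N_def)
    qed
    have p_take: "take n (p m) = p n" if "n \<le> m" for n m
      using that by (simp add: p_def take_map)
    have "simple_loop g w (p N)"
      unfolding simple_loop_def
    proof (intro conjI allI impI)
      fix l j assume lj: "j < length w" "l < j"
      have "take (f l j) (word_act g (take l w) (p N)) \<noteq> take (f l j) (word_act g (take j w) (p N))"
        using f[OF lj(2,1)] fN[of l j] lj by (simp add: Aut_take[OF takeA] p_take)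
      thus "word_act g (take l w) (p N) \<noteq> word_act g (take j w) (p N)" by metis
    qed (rule fixed)
    moreover have "\<exists>y\<in>level m. word_act g w (p N @ y) = p N @ y" for m
    proof
      have "p (N + m) = p N @ map \<xi> [N..<N + m]"
        using upt_add_eq_append[of 0 N m] by (simp add: p_def)
      thus "word_act g w (p N @ map \<xi> [N..<N + m]) = p N @ map \<xi> [N..<N + m]" using fixed[of "N + m"] by simp
    qed (simp add: level_def)
    moreover have "p N \<noteq> []" by (simp add: p_def N_def)
    ultimately show False using no_loop[OF less.prems] by blast
  qed
qed

lemma word_act_red_cons:
  assumes "\<And>b. b \<in> set (a # w) \<Longrightarrow> g (fst b) \<in> carrier Aut"
  shows "word_act g (red_cons a w) = word_act g w \<circ> letter_act g a"
proof (cases w)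
  case (Cons b w')
  show ?thesis
  proof (cases "b = letter_inv a")
    case True
    have "g (fst a) \<in> carrier Aut" using assms by simp
    hence "letter_act g b \<circ> letter_act g a = id"
      using True by (auto simp: letter_act_def letter_inv_def fun_eq_iff Aut_inv_inv)
    thus ?thesis using True Cons by (simp add: comp_assoc)
  qed (use Cons in simp)
qed simp

lemma word_act_foldr_red_cons:
  assumes "\<And>b. b \<in> set u \<union> set v \<Longrightarrow> g (fst b) \<in> carrier Aut"
  shows "word_act g (foldr red_cons u v) = word_act g v \<circ> word_act g u"
  using assms
proof (induction u)
  case (Cons a u)
  have "g (fst b) \<in> carrier Aut" if "b \<in> set (a # foldr red_cons u v)" for b
  proof -
    have "fst b \<in> fst ` (set (a # u) \<union> set v)"
      using set_foldr_red_cons[of u v] that by auto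
    then obtain b' where "b' \<in> set (a # u) \<union> set v" "fst b = fst b'" by (rule imageE)
    thus ?thesis using Cons.prems by simp
  qed
  from word_act_red_cons[of a "foldr red_cons u v" g, OF this]
  have "word_act g (foldr red_cons (a # u) v) = word_act g (foldr red_cons u v) \<circ> letter_act g a"
    by simp
  also have "word_act g (foldr red_cons u v) = word_act g v \<circ> word_act g u"
    by (rule Cons.IH) (use Cons.prems in auto)
  finally show ?case by (simp add: o_assoc)
qed simp

lemma generate_eq_word_act:
  fixes k :: nat
  assumes g: "\<And>i. i < k \<Longrightarrow> g i \<in> carrier Aut"
  shows "generate Aut (g ` {..<k}) = word_act g ` carrier (free_group {..<k})"
proof (intro equalityI subsetI)
  have letters: "g (fst b) \<in> carrier Aut" if "fst ` set w \<subseteq> {..<k}" "b \<in> set w" for w :: "(nat \<times> bool) list" and b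
    using g that by auto
  fix h assume "h \<in> generate Aut (g ` {..<k})"
  thus "h \<in> word_act g ` carrier (free_group {..<k})"
  proof (induction rule: generate.induct)
    case one
    have "[] \<in> carrier (free_group {..<k})" by (simp add: free_group_def reduced_def)
    moreover have "\<one>\<^bsub>Aut\<^esub> = word_act g []" by (simp only: Aut_sel word_act.simps)
    ultimately show ?case by blast
  next
    case (incl h)
    then obtain i where i: "i < k" "h = g i" by auto
    have "[(i, True)] \<in> carrier (free_group {..<k})" using i by (simp add: free_group_def reduced_def)
    moreover have "h = word_act g [(i, True)]" using i by (simp add: letter_act_def)
    ultimately show ?case by blast
  next
    case (inv h)
    then obtain i where i: "i < k" "h = g i" by auto
    have "[(i, False)] \<in> carrier (free_group {..<k})" using i by (simp add: free_group_def reduced_def)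
    moreover have "m_inv Aut h = word_act g [(i, False)]" using i g by (simp add: letter_act_def m_inv_Aut)
    ultimately show ?case by blast
  next
    case (eng h1 h2)
    then obtain u v where u: "u \<in> carrier (free_group {..<k})" "h1 = word_act g u"
      and v: "v \<in> carrier (free_group {..<k})" "h2 = word_act g v" by blast
    have "foldr red_cons u v \<in> carrier (free_group {..<k})"
      using monoid.m_closed[OF group.is_monoid[OF group_free_group] u(1) v(1)] by (simp add: free_group_def)
    moreover have "word_act g (foldr red_cons u v) = h2 \<circ> h1"
      unfolding u(2) v(2) using u(1) v(1) letters
      by (intro word_act_foldr_red_cons) (auto simp: free_group_def)
    ultimately show ?case unfolding Aut_sel by (metis imageI)
  qed
next
  fix h assume "h \<in> word_act g ` carrier (free_group {..<k})"
  then obtain w where w: "fst ` set w \<subseteq> {..<k}" "h = word_act g w" by (auto simp: free_group_def)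
  have "g ` {..<k} \<subseteq> carrier Aut" using g by auto
  hence "subgroup (generate Aut (g ` {..<k})) Aut" by (rule group.generate_is_subgroup[OF group_Aut])
  thus "h \<in> generate Aut (g ` {..<k})"
    unfolding w(2) using w(1) by (intro word_act_subgroup) (auto intro: generate.incl)
qed

text \<open>
  Evaluation of reduced words is a homomorphism onto the generated subgroup. Its kernel is trivial
  since the identity fixes every boundary point.
\<close>

lemma free_and_acts_freely_if_no_fixed_ends:
  assumes g: "\<And>i. i < k \<Longrightarrow> g i \<in> carrier Aut"
    and free: "\<And>w \<xi>. fst ` set w \<subseteq> {..<k} \<Longrightarrow> reduced w \<Longrightarrow> w \<noteq> [] \<Longrightarrow> boundary_act (word_act g w) \<xi> \<noteq> \<xi>"
  shows "free_group_of_rank (Aut\<lparr>carrier := generate Aut (g ` {..<k})\<rparr>) k"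
    and "acts_freely_on_boundary (generate Aut (g ` {..<k}))"
proof -
  let ?F = "free_group {..<k}" and ?H = "Aut\<lparr>carrier := generate Aut (g ` {..<k})\<rparr>"
  have gen: "generate Aut (g ` {..<k}) = word_act g ` carrier ?F" by (rule generate_eq_word_act[OF g])
  have hom: "word_act g (u \<otimes>\<^bsub>?F\<^esub> v) = word_act g u \<otimes>\<^bsub>Aut\<^esub> word_act g v"
    if "u \<in> carrier ?F" "v \<in> carrier ?F" for u v
  proof -
    have "word_act g (foldr red_cons u v) = word_act g v \<circ> word_act g u"
      using that g by (intro word_act_foldr_red_cons) (auto simp: free_group_def)
    thus ?thesis unfolding Aut_sel by (simp add: free_group_def)
  qed
  have trivial: "w = []" if "w \<in> carrier ?F" "word_act g w = id" for w
  proof (rule ccontr)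
    assume "w \<noteq> []"
    moreover have "boundary_act (word_act g w) \<xi> = \<xi>" for \<xi> :: "nat \<Rightarrow> 'a"
      unfolding that(2) by (simp add: boundary_act_def fun_eq_iff del: upt_Suc)
    ultimately show False using free that(1) by (auto simp: free_group_def)
  qed
  interpret F: group ?F by (rule group_free_group)
  interpret A: group Aut by (rule group_Aut)
  have "g ` {..<k} \<subseteq> carrier Aut" using g by auto
  hence sub: "subgroup (generate Aut (g ` {..<k})) Aut" by (rule A.generate_is_subgroup)
  interpret H: group ?H by (rule subgroup.subgroup_is_group[OF sub group_Aut])
  have hom_H: "word_act g \<in> hom ?F ?H"
    using hom by (auto simp: hom_def gen)
  interpret h: group_hom ?F ?H "word_act g"
    by unfold_locales (rule hom_H)
  have "inj_on (word_act g) (carrier ?F)"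
  proof (subst h.inj_on_one_iff, intro allI impI)
    fix w assume "w \<in> carrier ?F" "word_act g w = \<one>\<^bsub>?H\<^esub>"
    thus "w = \<one>\<^bsub>?F\<^esub>" using trivial[of w] by (simp add: free_group_def)
  qed
  hence "word_act g \<in> iso ?F ?H" using hom_H gen by (simp add: iso_def bij_betw_def)
  hence "?F \<cong> ?H" by (auto simp: is_iso_def)
  thus "free_group_of_rank ?H k" unfolding free_group_of_rank_def by (rule F.iso_sym)
  show "acts_freely_on_boundary (generate Aut (g ` {..<k}))"
    unfolding acts_freely_on_boundary_def gen
  proof (intro ballI impI allI)
    fix h \<xi> assume "h \<in> word_act g ` carrier ?F" "h \<noteq> \<one>\<^bsub>Aut\<^esub>"
    then obtain w where w: "w \<in> carrier ?F" "h = word_act g w" "h \<noteq> id" by auto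
    hence "w \<noteq> []" by auto
    thus "boundary_act h \<xi> \<noteq> \<xi>" using free[of w \<xi>] w by (simp add: free_group_def)
  qed
qed

theorem theorem1:
  fixes G :: "('x::finite list \<Rightarrow> 'x list) set"
    and \<mu> :: "('x list \<Rightarrow> 'x list) measure"
  assumes "CARD('x) \<ge> 2"
    and "profinite_subgroup G"
    and "super_strongly_fractal G"
    and "branch G"
    and "normalized_Haar G \<mu>"
  shows "\<forall>k\<ge>1. AE g in PiM {..<k} (\<lambda>_. \<mu>).
           free_group_of_rank (Aut\<lparr>carrier := generate Aut (g ` {..<k})\<rparr>) k \<and>
           acts_freely_on_boundary (generate Aut (g ` {..<k}))"
proof (intro allI impI)
  fix k :: nat
  interpret super_strongly_fractal_branch_group G \<mu>
    by unfold_locales (rule assms)+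
  let ?W = "{w. fst ` set w \<subseteq> {..<k} \<and> reduced w \<and> w \<noteq> []}"
  have "AE g in tuples k. \<not> loop_fixing_end w v g" if "w \<in> ?W" "v \<noteq> []" for w v
    using that by (intro AE_no_loop_fixing_end[OF assms(1)]) auto
  hence "AE g in tuples k. \<forall>w v. w \<in> ?W \<longrightarrow> v \<noteq> [] \<longrightarrow> \<not> loop_fixing_end w v g"
    by (simp only: AE_all_countable) (simp add: AE_all_countable)
  hence "AE g in tuples k. free_group_of_rank (Aut\<lparr>carrier := generate Aut (g ` {..<k})\<rparr>) k \<and>
           acts_freely_on_boundary (generate Aut (g ` {..<k}))"
  proof (rule AE_mp[OF _ AE_I2], intro impI)
    fix g assume g: "g \<in> space (tuples k)"
      and no: "\<forall>w v. w \<in> ?W \<longrightarrow> v \<noteq> [] \<longrightarrow> \<not> loop_fixing_end w v g"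
    have gA: "g i \<in> carrier Aut" if "i < k" for i using tuples_in_G[OF g that] G_Aut by blast
    have "boundary_act (word_act g w) \<xi> \<noteq> \<xi>" if "fst ` set w \<subseteq> {..<k}" "reduced w" "w \<noteq> []" for w \<xi>
      by (rule words_without_fixed_ends[OF gA _ that])
         (use no in \<open>auto simp: loop_fixing_end_def\<close>)
    from free_and_acts_freely_if_no_fixed_ends[OF gA this]
    show "free_group_of_rank (Aut\<lparr>carrier := generate Aut (g ` {..<k})\<rparr>) k \<and>
           acts_freely_on_boundary (generate Aut (g ` {..<k}))" by blast
  qed
  thus "AE g in PiM {..<k} (\<lambda>_. \<mu>). free_group_of_rank (Aut\<lparr>carrier := generate Aut (g ` {..<k})\<rparr>) k \<and>
           acts_freely_on_boundary (generate Aut (g ` {..<k}))"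
    unfolding tuples_def .
qed

end
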